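(* The Perron–Frobenius operator $\mathcal{P}_\sigma$ of the shift $\sigma$ on the Hilbert space $L^2(\Lambda_A,\mu_A)$, with $\mu_A$ the Hausdorff measure of dimension $\delta_A=\dim_H(\Lambda_A)$, satisfies $$\mathcal{P}_\sigma=N^{-\delta_A/2}\sum_{i=0}^{N-1}S_i^*.$$
   Context: Let $A=(A_{ij})_{i,j=0,\dots,N-1}$ ($N\ge2$) be a matrix with entries in $\{0,1\}$ and $A_{ii}=1$ for all $i$. $\Lambda_A$ is the set of infinite sequences $x=(x_1x_2x_3\dots)$ with $x_i\in\{0,\dots,N-1\}$ and $A_{x_ix_{i+1}}=1$ for all $i\ge1$. It is identified with a subset of $[0,1]$ through the value $\mathrm{val}(x)=\sum_{i\ge1}x_iN^{-i}$, points with two admissible expansions being counted as two points. $\delta_A$ is the Hausdorff dimension of $\mathrm{val}(\Lambda_A)\subset[0,1]$, and $\mu_A$ is the $\delta_A$-dimensional Hausdorff measure $\mathcal{H}^{\delta_A}$ on $\Lambda_A$, i.e. $\mu_A(B)=\int_{[0,1]}\#\{w\in B:\mathrm{val}(w)=y\}\,d\mathcal{H}^{\delta_A}(y)$. $\sigma(x_1x_2x_3\dots)=(x_2x_3\dots)$ is the shift; $D_i=\{x\in\Lambda_A:A_{ix_1}=1\}$, $R_i=\{x\in\Lambda_A:x_1=i\}$, $\sigma_i:D_i\to R_i$, $\sigma_i(x)=ix$, and $\Phi_{\sigma_i}=d(\mu_A\circ\sigma_i)/d\mu_A$ on $D_i$. The operators $S_i$ on $L^2(\Lambda_A,\mu_A)$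 are $(S_if)(x)=\chi_{R_i}(x)\,\Phi_{\sigma_i}(\sigma(x))^{-1/2}f(\sigma(x))$ (they generate a representation of the Cuntz–Krieger algebra $O_A$). The Perron–Frobenius operator $\mathcal{P}_\sigma$ is the adjoint of the composition operator $(T_\sigma\psi)(x)=\psi(\sigma(x))$, i.e. $\int\overline{\psi}\,\mathcal{P}_\sigma(\xi)\,d\mu_A=\int\overline{T_\sigma(\psi)}\,\xi\,d\mu_A$. *)

theory Defs
  imports "HOL-Analysis.Analysis"
begin

section \<open>Hausdorff measure and dimension\<close>

(* diam(U)^s with the conventions diam({})^s = 0 and 0^0 = 1, so that the 0-dimensional measure is
   counting measure; "powr" alone would give 0 powr 0 = 0. *)
definition diam_pow :: "real \<Rightarrow> 'a::metric_space set \<Rightarrow> ennreal" where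
  "diam_pow s U = (if U = {} then 0 else if s = 0 then 1 else ennreal (diameter U powr s))"

(* "bounded" is needed because "diameter" is unspecified on unbounded sets. *)
definition hausdorff_premeasure :: "real \<Rightarrow> real \<Rightarrow> 'a::metric_space set \<Rightarrow> ennreal" where
  "hausdorff_premeasure s d X =
     (INF U \<in> {U :: nat \<Rightarrow> 'a set. X \<subseteq> (\<Union>k. U k) \<and> (\<forall>k. bounded (U k) \<and> diameter (U k) \<le> d)}.
        \<Sum>k. diam_pow s (U k))"

definition hausdorff_outer :: "real \<Rightarrow> 'a::metric_space set \<Rightarrow> ennreal" where
  "hausdorff_outer s X = (SUP d \<in> {0<..}. hausdorff_premeasure s d X)"

definition hausdorff_measure :: "real \<Rightarrow> 'a::metric_space measure" where
  "hausdorff_measure s = measure_of UNIV (sets borel) (hausdorff_outer s)"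

definition hausdorff_dim :: "'a::metric_space set \<Rightarrow> ennreal" where
  "hausdorff_dim X = (INF s \<in> {s. 0 \<le> s \<and> hausdorff_outer s X = 0}. ennreal s)"


section \<open>The sequence space and its Hausdorff measure\<close>

(* Sequences are indexed from 0: the letter x_i of the mathematical notation is x (i - 1). *)
definition Lam :: "nat \<Rightarrow> (nat \<Rightarrow> nat \<Rightarrow> nat) \<Rightarrow> (nat \<Rightarrow> nat) set" where
  "Lam N A = {x. (\<forall>k. x k < N) \<and> (\<forall>k. A (x k) (x (Suc k)) = 1)}"

definition val :: "nat \<Rightarrow> (nat \<Rightarrow> nat) \<Rightarrow> real" where
  "val N x = (\<Sum>k. real (x k) / real N ^ Suc k)"

(* The dimension of a subset of [0,1] is at most 1, so enn2real loses nothing. *)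
definition dimA :: "nat \<Rightarrow> (nat \<Rightarrow> nat \<Rightarrow> nat) \<Rightarrow> real" where
  "dimA N A = enn2real (hausdorff_dim (val N ` Lam N A))"

(* The sigma-algebra is that of the Borel sets for the product topology on sequences. A real number
   with two admissible expansions contributes twice, via the counting measure of the fibre. *)
definition muA :: "nat \<Rightarrow> (nat \<Rightarrow> nat \<Rightarrow> nat) \<Rightarrow> (nat \<Rightarrow> nat) measure" where
  "muA N A = measure_of (Lam N A) (sets (restrict_space borel (Lam N A)))
     (\<lambda>B. \<integral>\<^sup>+ y \<in> {0..1}. emeasure (count_space UNIV) {w \<in> B. val N w = y}
            \<partial>hausdorff_measure (dimA N A))"

definition shift :: "(nat \<Rightarrow> nat) \<Rightarrow> (nat \<Rightarrow> nat)" where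
  "shift x = (\<lambda>k. x (Suc k))"

definition prefix :: "nat \<Rightarrow> (nat \<Rightarrow> nat) \<Rightarrow> (nat \<Rightarrow> nat)" where
  "prefix i x = case_nat i x"

definition Dset :: "nat \<Rightarrow> (nat \<Rightarrow> nat \<Rightarrow> nat) \<Rightarrow> nat \<Rightarrow> (nat \<Rightarrow> nat) set" where
  "Dset N A i = {x \<in> Lam N A. A i (x 0) = 1}"

definition Rset :: "nat \<Rightarrow> (nat \<Rightarrow> nat \<Rightarrow> nat) \<Rightarrow> nat \<Rightarrow> (nat \<Rightarrow> nat) set" where
  "Rset N A i = {x \<in> Lam N A. x 0 = i}"

definition mu_prefix :: "nat \<Rightarrow> (nat \<Rightarrow> nat \<Rightarrow> nat) \<Rightarrow> nat \<Rightarrow> (nat \<Rightarrow> nat) measure" where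
  "mu_prefix N A i = measure_of (Dset N A i) (sets (restrict_space (muA N A) (Dset N A i)))
     (\<lambda>B. emeasure (muA N A) (prefix i ` B))"

definition Phi :: "nat \<Rightarrow> (nat \<Rightarrow> nat \<Rightarrow> nat) \<Rightarrow> nat \<Rightarrow> (nat \<Rightarrow> nat) \<Rightarrow> real" where
  "Phi N A i x = enn2real (RN_deriv (restrict_space (muA N A) (Dset N A i)) (mu_prefix N A i) x)"


section \<open>Operators on the Hilbert space of square-integrable functions\<close>

(* Elements are represented by functions; equality of elements is equality almost everywhere. *)
definition L2 :: "'a measure \<Rightarrow> ('a \<Rightarrow> complex) set" where
  "L2 M = {f \<in> borel_measurable M. integrable M (\<lambda>x. (cmod (f x))\<^sup>2)}"

definition L2_inner :: "'a measure \<Rightarrow> ('a \<Rightarrow> complex) \<Rightarrow> ('a \<Rightarrow> complex) \<Rightarrow> complex" where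
  "L2_inner M f g = (\<integral>x. cnj (f x) * g x \<partial>M)"

(* A representative of the adjoint applied to xi; it is determined up to a null set. *)
definition L2_adjoint ::
  "'a measure \<Rightarrow> (('a \<Rightarrow> complex) \<Rightarrow> ('a \<Rightarrow> complex)) \<Rightarrow> ('a \<Rightarrow> complex) \<Rightarrow> ('a \<Rightarrow> complex)" where
  "L2_adjoint M T \<xi> =
     (SOME \<eta>. \<eta> \<in> L2 M \<and> (\<forall>\<psi>\<in>L2 M. L2_inner M \<psi> \<eta> = L2_inner M (T \<psi>) \<xi>))"

definition S_op ::
  "nat \<Rightarrow> (nat \<Rightarrow> nat \<Rightarrow> nat) \<Rightarrow> nat \<Rightarrow> ((nat \<Rightarrow> nat) \<Rightarrow> complex) \<Rightarrow> (nat \<Rightarrow> nat) \<Rightarrow> complex" where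
  "S_op N A i f x =
     indicator (Rset N A i) x * complex_of_real (Phi N A i (shift x) powr (- 1 / 2)) * f (shift x)"

definition T_shift :: "((nat \<Rightarrow> nat) \<Rightarrow> complex) \<Rightarrow> (nat \<Rightarrow> nat) \<Rightarrow> complex" where
  "T_shift \<psi> x = \<psi> (shift x)"

definition perron_frobenius ::
  "nat \<Rightarrow> (nat \<Rightarrow> nat \<Rightarrow> nat) \<Rightarrow> ((nat \<Rightarrow> nat) \<Rightarrow> complex) \<Rightarrow> (nat \<Rightarrow> nat) \<Rightarrow> complex" where
  "perron_frobenius N A = L2_adjoint (muA N A) T_shift"

end

theory Submission
  imports Defs
begin

text \<open>
  Write \<open>\<delta>\<close> for the dimension \<open>dimA N A\<close> and \<open>\<mu>\<close> for \<open>muA N A\<close>. Prefixing a letter \<open>i\<close> is the affine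
  contraction \<open>y \<mapsto> (i + y) / N\<close> on values, and Hausdorff measure of dimension \<open>\<delta>\<close> scales by \<open>N powr (- \<delta>)\<close>
  under it. Hence \<open>\<mu> (prefix i ` B) = N powr (- \<delta>) * \<mu> B\<close> for Borel sets \<open>B \<subseteq> Dset N A i\<close>
  (\<open>emeasure_prefix_image\<close>), so the Radon-Nikodym derivative \<open>Phi N A i\<close> is the constant \<open>N powr (- \<delta>)\<close>
  and the generator is \<open>S_op N A i f x = N powr (\<delta> / 2) * f (shift x)\<close> on \<open>Rset N A i\<close>, almost everywhere.
  A change of variables on each \<open>Rset N A i\<close> then identifies both adjoints: that of \<open>S_op N A i\<close> sends
  \<open>\<xi>\<close> to \<open>N powr (- \<delta> / 2) * \<xi> (i x)\<close> on \<open>Dset N A i\<close> and to 0 elsewhere, and that of the composition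
  operator sends \<open>\<xi>\<close> to the sum over \<open>i\<close> of the same functions with the factor \<open>N powr (- \<delta>)\<close> instead.
  The theorem compares the two factors.

  Two points need work. First, \<open>\<mu>\<close> has to be a measure with the stated values: Caratheodory's
  criterion shows that Borel sets are measurable for the Hausdorff outer measure, and the number of
  points of a Borel set \<open>B\<close> with value \<open>y\<close> is a Borel function of \<open>y\<close>, because the at most two expansions of \<open>y\<close>
  depend measurably on \<open>y\<close>.

  Second, \<open>\<mu>\<close> has to be shown sigma-finite, which makes the Radon-Nikodym derivative unique almost everywhere.
  The measure can be infinite, since nothing is assumed about irreducibility of \<open>A\<close>. Every sequence is,
  after finitely many letters, one that starts with a letter \<open>i\<close> and returns to \<open>i\<close> infinitely often, so it
  suffices that those sequences have finite measure. They are covered by as many cylinders of length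
  \<open>m\<close> as there are closed walks at \<open>i\<close> of length \<open>m + M\<close>, for a constant \<open>M\<close>. There are at most
  \<open>N powr (n * \<delta>)\<close> closed walks of length \<open>n\<close> (\<open>card_loops_le\<close>): otherwise the free concatenations of them
  would form a set of dimension greater than \<open>\<delta>\<close>, by the mass distribution principle.
\<close>

section \<open>Hausdorff measure on metric spaces\<close>

lemma diam_pow_empty [simp]: "diam_pow s {} = 0"
  by (simp add: diam_pow_def)

lemma diam_pow_mono:
  assumes "0 \<le> s" "bounded V" "U \<subseteq> V"
  shows "diam_pow s U \<le> diam_pow s V"
  using assms diameter_subset[OF assms(3,2)] diameter_ge_0[of U] bounded_subset[OF assms(2,3)]
  by (auto simp: diam_pow_def intro!: ennreal_leI powr_mono2)

lemma hausdorff_premeasure_le: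
  assumes "X \<subseteq> (\<Union>k. U k)" "\<And>k. bounded (U k)" "\<And>k. diameter (U k) \<le> d"
  shows "hausdorff_premeasure s d X \<le> (\<Sum>k. diam_pow s (U k))"
  unfolding hausdorff_premeasure_def by (rule INF_lower) (use assms in auto)

lemma hausdorff_premeasure_greatest:
  assumes "\<And>U. X \<subseteq> (\<Union>k. U k) \<Longrightarrow> (\<And>k. bounded (U k)) \<Longrightarrow> (\<And>k. diameter (U k) \<le> d) \<Longrightarrow>
                c \<le> (\<Sum>k::nat. diam_pow s (U k))"
  shows "c \<le> hausdorff_premeasure s d X"
  unfolding hausdorff_premeasure_def by (rule INF_greatest) (use assms in auto)

lemma hausdorff_premeasure_approx:
  assumes "hausdorff_premeasure s d X < c"
  obtains U where "X \<subseteq> (\<Union>k. U k)" "\<And>k. bounded (U k)" "\<And>k. diameter (U k) \<le> d"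
    "(\<Sum>k::nat. diam_pow s (U k)) < c"
  using assms unfolding hausdorff_premeasure_def INF_less_iff by auto

lemma hausdorff_premeasure_mono:
  assumes "X \<subseteq> Y"
  shows "hausdorff_premeasure s d X \<le> hausdorff_premeasure s d Y"
  by (rule hausdorff_premeasure_greatest) (use assms in \<open>auto intro!: hausdorff_premeasure_le\<close>)

lemma hausdorff_premeasure_antimono:
  assumes "d \<le> e"
  shows "hausdorff_premeasure s e X \<le> hausdorff_premeasure s d X"
  by (rule hausdorff_premeasure_greatest, rule hausdorff_premeasure_le)
     (use assms in \<open>auto intro: order_trans\<close>)

lemma hausdorff_premeasure_empty: "0 \<le> d \<Longrightarrow> hausdorff_premeasure s d {} = 0"
  using hausdorff_premeasure_le[of "{}" "\<lambda>_. {}" d s] by simp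

lemma hausdorff_premeasure_UN_le:
  "hausdorff_premeasure s d (\<Union>i::nat. X i) \<le> (\<Sum>i. hausdorff_premeasure s d (X i))"
proof (rule ennreal_le_epsilon)
  fix e :: real
  assume fin: "(\<Sum>i. hausdorff_premeasure s d (X i)) < top" and e: "0 < e"
  have "\<exists>U. X i \<subseteq> (\<Union>k. U k) \<and> (\<forall>k. bounded (U k) \<and> diameter (U k) \<le> d) \<and>
          (\<Sum>k::nat. diam_pow s (U k)) \<le> hausdorff_premeasure s d (X i) + ennreal (e * (1/2) ^ Suc i)" for i
  proof -
    have "hausdorff_premeasure s d (X i) < top"
      by (rule ennreal_suminf_lessD[OF fin])
    hence "hausdorff_premeasure s d (X i)
             < hausdorff_premeasure s d (X i) + ennreal (e * (1/2) ^ Suc i)"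
      using e by (simp add: ennreal_add_left_cancel_less[of _ 0, simplified])
    then obtain U where "X i \<subseteq> (\<Union>k. U k)" "\<And>k. bounded (U k)" "\<And>k. diameter (U k) \<le> d"
        "(\<Sum>k::nat. diam_pow s (U k)) < hausdorff_premeasure s d (X i) + ennreal (e * (1/2) ^ Suc i)"
      by (rule hausdorff_premeasure_approx) blast
    thus ?thesis by (auto intro: less_imp_le)
  qed
  then obtain U where U: "\<And>i. X i \<subseteq> (\<Union>k. U i k)" "\<And>i k. bounded (U i k)"
      "\<And>i k. diameter (U i k) \<le> d"
      "\<And>i. (\<Sum>k::nat. diam_pow s (U i k))
            \<le> hausdorff_premeasure s d (X i) + ennreal (e * (1/2) ^ Suc i)"
    by metis
  define V where "V k = (case prod_decode k of (i, j) \<Rightarrow> U i j)" for k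
  have "hausdorff_premeasure s d (\<Union>i. X i) \<le> (\<Sum>k. diam_pow s (V k))"
  proof (rule hausdorff_premeasure_le)
    show "(\<Union>i. X i) \<subseteq> (\<Union>k. V k)"
    proof
      fix x assume "x \<in> (\<Union>i. X i)"
      then obtain i j where "x \<in> U i j" using U(1) by blast
      hence "x \<in> V (prod_encode (i, j))" by (simp add: V_def)
      thus "x \<in> (\<Union>k. V k)" by blast
    qed
  qed (auto simp: V_def U split: prod.split)
  also have "\<dots> = (\<Sum>i. \<Sum>k. diam_pow s (U i k))"
    using suminf_ennreal_2dimen[of "\<lambda>i. \<Sum>k. diam_pow s (U i k)" "\<lambda>(i, k). diam_pow s (U i k)"]
    by (simp add: V_def split_def)
  also have "\<dots> \<le> (\<Sum>i. hausdorff_premeasure s d (X i) + ennreal (e * (1/2) ^ Suc i))"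
    by (intro suminf_le U) auto
  also have "\<dots> = (\<Sum>i. hausdorff_premeasure s d (X i)) + (\<Sum>i. ennreal (e * (1/2) ^ Suc i))"
    by (rule suminf_add[symmetric]) auto
  also have "(\<Sum>i. ennreal (e * (1/2) ^ Suc i)) = ennreal e"
    using sums_mult[OF power_half_series, of e] e by (intro suminf_ennreal_eq) auto
  finally show "hausdorff_premeasure s d (\<Union>i. X i) \<le> (\<Sum>i. hausdorff_premeasure s d (X i)) + ennreal e" .
qed

lemma hausdorff_premeasure_le_outer:
  "0 < d \<Longrightarrow> hausdorff_premeasure s d X \<le> hausdorff_outer s X"
  unfolding hausdorff_outer_def by (rule SUP_upper) auto

lemma hausdorff_outer_least:
  assumes "\<And>d. 0 < d \<Longrightarrow> hausdorff_premeasure s d X \<le> c"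
  shows "hausdorff_outer s X \<le> c"
  unfolding hausdorff_outer_def by (rule SUP_least) (use assms in auto)

lemma hausdorff_outer_empty [simp]: "hausdorff_outer s {} = 0"
  using hausdorff_outer_least[of s "{}" 0] by (simp add: hausdorff_premeasure_empty)

lemma hausdorff_outer_mono: "X \<subseteq> Y \<Longrightarrow> hausdorff_outer s X \<le> hausdorff_outer s Y"
  unfolding hausdorff_outer_def by (intro SUP_mono') (rule hausdorff_premeasure_mono)

lemma hausdorff_outer_UN_le:
  "hausdorff_outer s (\<Union>i::nat. X i) \<le> (\<Sum>i. hausdorff_outer s (X i))"
proof (rule hausdorff_outer_least)
  fix d :: real assume d: "0 < d"
  have "hausdorff_premeasure s d (\<Union>i. X i) \<le> (\<Sum>i. hausdorff_premeasure s d (X i))"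
    by (rule hausdorff_premeasure_UN_le)
  also have "\<dots> \<le> (\<Sum>i. hausdorff_outer s (X i))"
    by (intro suminf_le hausdorff_premeasure_le_outer d) auto
  finally show "hausdorff_premeasure s d (\<Union>i. X i) \<le> (\<Sum>i. hausdorff_outer s (X i))" .
qed

lemma hausdorff_outer_measure_space: "outer_measure_space UNIV (hausdorff_outer s)"
  by (auto simp: outer_measure_space_def positive_def increasing_def countably_subadditive_def
      intro: hausdorff_outer_mono hausdorff_outer_UN_le)

lemma hausdorff_outer_Un_le: "hausdorff_outer s (X \<union> Y) \<le> hausdorff_outer s X + hausdorff_outer s Y"
proof -
  have "hausdorff_outer s (X \<union> Y) = hausdorff_outer s (\<Union>i::nat. if i = 0 then X else if i = 1 then Y else {})"
    by (rule arg_cong[where f = "hausdorff_outer s"]) (auto split: if_splits)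
  also have "\<dots> \<le> (\<Sum>i::nat. hausdorff_outer s (if i = 0 then X else if i = 1 then Y else {}))"
    by (rule hausdorff_outer_UN_le)
  also have "\<dots> = (\<Sum>i\<in>{0, 1::nat}. hausdorff_outer s (if i = 0 then X else if i = 1 then Y else {}))"
    by (rule suminf_finite) auto
  finally show ?thesis by simp
qed

lemma hausdorff_outer_metric_additive:
  assumes s: "0 \<le> s" and r: "0 < r" and sep: "\<And>x y. x \<in> X \<Longrightarrow> y \<in> Y \<Longrightarrow> r \<le> dist x y"
  shows "hausdorff_outer s X + hausdorff_outer s Y \<le> hausdorff_outer s (X \<union> Y)"
proof -
  have pre: "hausdorff_premeasure s d X + hausdorff_premeasure s e Y \<le> hausdorff_outer s (X \<union> Y)"
    if "0 < d" "0 < e" for d e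
  proof -
    define c where "c = min (min d e) (r / 2)"
    have c: "0 < c" "c < r" "c \<le> d" "c \<le> e" using that r by (auto simp: c_def)
    have "hausdorff_premeasure s d X + hausdorff_premeasure s e Y
            \<le> hausdorff_premeasure s c X + hausdorff_premeasure s c Y"
      by (intro add_mono hausdorff_premeasure_antimono c)
    also have "\<dots> \<le> hausdorff_premeasure s c (X \<union> Y)"
    proof (rule hausdorff_premeasure_greatest)
      fix U :: "nat \<Rightarrow> 'a set"
      assume U: "X \<union> Y \<subseteq> (\<Union>k. U k)" "\<And>k. bounded (U k)" "\<And>k. diameter (U k) \<le> c"
      have diam: "diameter (U k \<inter> Z) \<le> c" for k Z
        using diameter_subset[of "U k \<inter> Z" "U k"] U(2,3)[of k] by auto
      have "hausdorff_premeasure s c X + hausdorff_premeasure s c Y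
              \<le> (\<Sum>k. diam_pow s (U k \<inter> X)) + (\<Sum>k. diam_pow s (U k \<inter> Y))"
        by (intro add_mono hausdorff_premeasure_le diam bounded_Int) (use U in auto)
      also have "\<dots> = (\<Sum>k. diam_pow s (U k \<inter> X) + diam_pow s (U k \<inter> Y))"
        by (rule suminf_add) auto
      also have "\<dots> \<le> (\<Sum>k. diam_pow s (U k))"
      proof (intro suminf_le)
        fix k
        have "U k \<inter> X = {} \<or> U k \<inter> Y = {}"
        proof (rule ccontr)
          assume "\<not> ?thesis"
          then obtain x y where "x \<in> U k" "x \<in> X" "y \<in> U k" "y \<in> Y" by auto
          with sep[of x y] diameter_bounded_bound[OF U(2)[of k], of x y] U(3)[of k] c(2)
          show False by auto
        qed
        thus "diam_pow s (U k \<inter> X) + diam_pow s (U k \<inter> Y) \<le> diam_pow s (U k)"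
          using diam_pow_mono[OF s U(2)[of k], of "U k \<inter> X"] diam_pow_mono[OF s U(2)[of k], of "U k \<inter> Y"]
          by auto
      qed auto
      finally show "hausdorff_premeasure s c X + hausdorff_premeasure s c Y \<le> (\<Sum>k. diam_pow s (U k))" .
    qed
    also have "\<dots> \<le> hausdorff_outer s (X \<union> Y)" by (rule hausdorff_premeasure_le_outer) (rule c)
    finally show ?thesis .
  qed
  have "hausdorff_premeasure s d X + hausdorff_outer s Y \<le> hausdorff_outer s (X \<union> Y)" if "0 < d" for d
    unfolding hausdorff_outer_def[of s Y]
    by (subst ennreal_SUP_add_right) (use that in \<open>auto intro!: SUP_least pre\<close>)
  thus ?thesis
    unfolding hausdorff_outer_def[of s X]
    by (subst ennreal_SUP_add_left[symmetric]) (auto intro!: SUP_least)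
qed

lemma sum_even_odd: "(\<Sum>k<2 * n. f k) = (\<Sum>k<n. f (2 * k)) + (\<Sum>k<n. f (2 * k + 1 :: nat) :: 'b :: comm_monoid_add)"
  by (induction n) (auto simp: algebra_simps)

text \<open>
  Caratheodory's criterion for closed sets. The part of \<open>X\<close> outside \<open>F\<close> is cut into the
  shells \<open>R k\<close> of points at distance between \<open>1 / (k + 2)\<close> and \<open>1 / (k + 1)\<close> from \<open>F\<close>. Shells
  whose indices differ by at least two have a positive distance, so the measures of the shells have
  a finite sum and those close to \<open>F\<close> contribute arbitrarily little.
\<close>

lemma hausdorff_outer_closed_split:
  fixes F :: "'a :: metric_space set"
  assumes s: "0 \<le> s" and F: "closed F"
  shows "hausdorff_outer s (X \<inter> F) + hausdorff_outer s (X - F) \<le> hausdorff_outer s X"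
proof (cases "F = {} \<or> hausdorff_outer s X = top")
  case True
  thus ?thesis by auto
next
  case False
  define D where "D x = infdist x F" for x
  define A where "A n = {x \<in> X. 1 / real (Suc n) \<le> D x}" for n
  define R where "R k = {x \<in> X. 1 / real (k + 2) \<le> D x \<and> D x < 1 / real (k + 1)}" for k
  let ?H = "hausdorff_outer s"
  have dist: "D x - D y \<le> dist x y" for x y
    using infdist_triangle[of x F y] by (simp add: D_def)
  have finX: "?H X < top" using False by (simp add: less_top)
  have shells: "(\<Sum>k<n. ?H (R (2 * k + p))) \<le> ?H (\<Union>k<n. R (2 * k + p))" for n p
  proof (induction n)
    case (Suc n)
    show ?case
    proof (cases "n = 0")
      case False
      have "(\<Sum>k<Suc n. ?H (R (2 * k + p))) \<le> ?H (\<Union>k<n. R (2 * k + p)) + ?H (R (2 * n + p))"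
        using Suc.IH by (simp add: add_right_mono)
      also have "\<dots> \<le> ?H ((\<Union>k<n. R (2 * k + p)) \<union> R (2 * n + p))"
      proof (rule hausdorff_outer_metric_additive[OF s])
        show "0 < 1 / real (2 * n + p) - 1 / real (2 * n + p + 1)"
          using False by (simp add: divide_strict_left_mono)
        fix x y assume "x \<in> (\<Union>k<n. R (2 * k + p))" and y: "y \<in> R (2 * n + p)"
        then obtain k where k: "k < n" "1 / real (2 * k + p + 2) \<le> D x" by (auto simp: R_def)
        have "1 / real (2 * n + p) \<le> 1 / real (2 * k + p + 2)"
          using k(1) by (intro divide_left_mono) auto
        with k(2) y show "1 / real (2 * n + p) - 1 / real (2 * n + p + 1) \<le> dist x y"
          using dist[of x y] by (auto simp: R_def)
      qed
      also have "(\<Union>k<n. R (2 * k + p)) \<union> R (2 * n + p) = (\<Union>k<Suc n. R (2 * k + p))"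
        by (auto simp: less_Suc_eq)
      finally show ?thesis .
    qed auto
  qed simp
  have shells_le: "(\<Sum>k<n. ?H (R (2 * k + p))) \<le> ?H X" for n p
    by (rule order_trans[OF shells hausdorff_outer_mono]) (auto simp: R_def)
  have "(\<Sum>k. ?H (R k)) \<le> ?H X + ?H X"
  proof (rule suminf_le_const)
    fix n
    have "(\<Sum>k<n. ?H (R k)) \<le> (\<Sum>k<2 * n. ?H (R k))" by (rule sum_mono2) auto
    also have "\<dots> \<le> ?H X + ?H X"
      unfolding sum_even_odd using shells_le[of 0 n] shells_le[of 1 n]
      by (intro add_mono) auto
    finally show "(\<Sum>k<n. ?H (R k)) \<le> ?H X + ?H X" .
  qed auto
  hence finR: "(\<Sum>k. ?H (R k)) < top" using finX by (simp add: le_less_trans)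
  have cover: "X - F \<subseteq> A n \<union> (\<Union>k. R (k + n))" for n
  proof
    fix x assume x: "x \<in> X - F"
    hence pos: "0 < D x"
      using F False by (simp add: D_def infdist_nonneg in_closed_iff_infdist_zero less_le)
    show "x \<in> A n \<union> (\<Union>k. R (k + n))"
    proof (cases "1 / real (Suc n) \<le> D x")
      case False
      obtain m where m: "1 / real (Suc m) < D x" using pos nat_approx_posE by blast
      define j where "j = (LEAST m. 1 / real (Suc m) \<le> D x)"
      have j: "1 / real (Suc j) \<le> D x"
        unfolding j_def by (rule LeastI[of _ m]) (use m in simp)
      have nj: "n < j"
      proof (rule ccontr)
        assume "\<not> n < j"
        hence "1 / real (Suc n) \<le> 1 / real (Suc j)" by (intro divide_left_mono) auto
        with j False show False by simp
      qed
      then obtain i where i: "j = Suc i" "n \<le> i" by (cases j) auto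
      have "\<not> 1 / real (Suc i) \<le> D x"
        by (rule not_less_Least) (use i in \<open>simp add: j_def\<close>)
      hence "D x < 1 / real (Suc i)" by simp
      hence "x \<in> R i" using j i x by (simp add: R_def)
      moreover have "i = (i - n) + n" using i by simp
      ultimately show ?thesis by (metis UN_I UNIV_I UnI2)
    qed (use x in \<open>auto simp: A_def\<close>)
  qed
  have "(\<Sum>k. ?H (R k)) + (?H (X \<inter> F) + ?H (X - F)) \<le> (\<Sum>k. ?H (R k)) + ?H X"
  proof (rule ennreal_suminf_bound_add)
    fix n
    have "?H (X - F) \<le> ?H (A n) + (\<Sum>k. ?H (R (k + n)))"
      by (rule order_trans[OF hausdorff_outer_mono[OF cover[of n]]], rule order_trans[OF hausdorff_outer_Un_le])
         (intro add_left_mono hausdorff_outer_UN_le)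
    hence "(\<Sum>k<n. ?H (R k)) + (?H (X \<inter> F) + ?H (X - F))
             \<le> (\<Sum>k<n. ?H (R k)) + (?H (X \<inter> F) + (?H (A n) + (\<Sum>k. ?H (R (k + n)))))"
      by (intro add_left_mono)
    also have "\<dots> = (?H (X \<inter> F) + ?H (A n)) + ((\<Sum>k. ?H (R (k + n))) + (\<Sum>k<n. ?H (R k)))"
      by (simp add: ac_simps)
    also have "(\<Sum>k. ?H (R (k + n))) + (\<Sum>k<n. ?H (R k)) = (\<Sum>k. ?H (R k))"
      by (rule suminf_offset[symmetric]) auto
    also have "?H (X \<inter> F) + ?H (A n) \<le> ?H (X \<inter> F \<union> A n)"
    proof (rule hausdorff_outer_metric_additive[OF s])
      show "0 < 1 / real (Suc n)" by simp
      fix x y assume "x \<in> X \<inter> F" "y \<in> A n"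
      thus "1 / real (Suc n) \<le> dist x y"
        using infdist_le[of x F y] by (auto simp: A_def D_def dist_commute)
    qed
    also have "\<dots> \<le> ?H X" by (rule hausdorff_outer_mono) (auto simp: A_def)
    finally show "(\<Sum>k<n. ?H (R k)) + (?H (X \<inter> F) + ?H (X - F)) \<le> (\<Sum>k. ?H (R k)) + ?H X"
      by (simp add: ac_simps add_right_mono)
  qed
  thus ?thesis using finR by (auto simp: ennreal_add_left_cancel_le)
qed

lemma sets_hausdorff_measure [simp, measurable_cong]:
  "sets (hausdorff_measure s :: 'a :: metric_space measure) = sets borel"
  using sets.sigma_sets_eq[of "borel :: 'a :: metric_space measure"] by (simp add: hausdorff_measure_def)

lemma space_hausdorff_measure [simp]: "space (hausdorff_measure s) = UNIV"
  by (simp add: hausdorff_measure_def)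

lemma measure_space_hausdorff_outer:
  assumes "0 \<le> s"
  shows "measure_space UNIV (sets borel) (hausdorff_outer s :: 'a :: metric_space set \<Rightarrow> ennreal)"
proof -
  let ?H = "hausdorff_outer s :: 'a set \<Rightarrow> ennreal"
  interpret P: sigma_algebra "UNIV :: 'a set" "Pow UNIV" by (rule sigma_algebra_Pow)
  let ?L = "lambda_system UNIV (Pow UNIV) ?H"
  have L: "measure_space UNIV ?L ?H"
    using P.caratheodory_lemma[of ?H] hausdorff_outer_measure_space[of s] by simp
  then interpret L: sigma_algebra UNIV ?L by (simp add: measure_space_def)
  have "F \<in> ?L" if "closed F" for F
    unfolding P.lambda_system_eq
  proof safe
    fix X
    have "?H ((X \<inter> F) \<union> (X - F)) \<le> ?H (X \<inter> F) + ?H (X - F)" by (rule hausdorff_outer_Un_le)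
    moreover have "(X \<inter> F) \<union> (X - F) = X" by auto
    ultimately show "?H (X \<inter> F) + ?H (X - F) = ?H X"
      using hausdorff_outer_closed_split[OF assms that, of X] by (intro antisym) auto
  qed auto
  hence "sigma_sets UNIV {F. closed F} \<subseteq> ?L" by (intro L.sigma_sets_subset) auto
  hence "sets borel \<subseteq> ?L" by (simp add: borel_eq_closed)
  thus ?thesis
    using L sets.sigma_algebra_axioms[of "borel :: 'a measure"]
    by (auto simp: measure_space_def positive_def countably_additive_def subset_iff)
qed

lemma emeasure_hausdorff_measure:
  assumes "0 \<le> s" "B \<in> sets borel"
  shows "emeasure (hausdorff_measure s) B = hausdorff_outer s B"
  using measure_space_hausdorff_outer[OF assms(1), where 'a='a] assms(2) sets.space_closed[of "borel :: 'a measure"]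
  unfolding hausdorff_measure_def
  by (intro emeasure_measure_of_sigma) (auto simp: measure_space_def)

lemma ennreal_le_mult_iff:
  assumes "0 < c"
  shows "x \<le> ennreal c * y \<longleftrightarrow> ennreal (1 / c) * x \<le> y"
proof
  have c: "ennreal (1 / c) * ennreal c = 1" "ennreal c * ennreal (1 / c) = 1"
    using assms by (auto simp flip: ennreal_mult)
  show "ennreal (1 / c) * x \<le> y" if "x \<le> ennreal c * y"
    using mult_left_mono[OF that, of "ennreal (1 / c)"] by (simp add: mult.assoc[symmetric] c)
  show "x \<le> ennreal c * y" if "ennreal (1 / c) * x \<le> y"
    using mult_left_mono[OF that, of "ennreal c"] by (simp add: mult.assoc[symmetric] c)
qed

lemma hausdorff_outer_lipschitz_le:
  fixes f :: "'a :: metric_space \<Rightarrow> 'b :: metric_space"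
  assumes s: "0 \<le> s" and c: "0 < c"
    and lip: "\<And>x y. x \<in> X \<Longrightarrow> y \<in> X \<Longrightarrow> dist (f x) (f y) \<le> c * dist x y"
  shows "hausdorff_outer s (f ` X) \<le> ennreal (c powr s) * hausdorff_outer s X"
proof (rule hausdorff_outer_least)
  fix d :: real assume d: "0 < d"
  have cs: "0 < c powr s" using c by simp
  have "hausdorff_premeasure s d (f ` X) \<le> ennreal (c powr s) * hausdorff_premeasure s (d / c) X"
    unfolding ennreal_le_mult_iff[OF cs]
  proof (rule hausdorff_premeasure_greatest, unfold ennreal_le_mult_iff[OF cs, symmetric])
    fix U :: "nat \<Rightarrow> 'a set"
    assume U: "X \<subseteq> (\<Union>k. U k)" "\<And>k. bounded (U k)" "\<And>k. diameter (U k) \<le> d / c"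
    have dist_le: "dist x y \<le> c * diameter (U k)" if "x \<in> f ` (U k \<inter> X)" "y \<in> f ` (U k \<inter> X)" for x y k
    proof -
      from that obtain a b where ab: "a \<in> U k" "a \<in> X" "b \<in> U k" "b \<in> X" "x = f a" "y = f b" by auto
      have "dist x y \<le> c * dist a b" using lip ab by simp
      also have "\<dots> \<le> c * diameter (U k)"
        using diameter_bounded_bound[OF U(2) ab(1,3)] c by simp
      finally show ?thesis .
    qed
    have bd: "bounded (f ` (U k \<inter> X))" for k
      unfolding bounded_two_points using dist_le by blast
    have diam: "diameter (f ` (U k \<inter> X)) \<le> c * diameter (U k)" for k
    proof (cases "U k \<inter> X = {}")
      case False
      hence "(SUP (x, y)\<in>f ` (U k \<inter> X) \<times> f ` (U k \<inter> X). dist x y) \<le> c * diameter (U k)"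
        by (intro cSUP_least) (use dist_le[of _ k] in auto)
      thus ?thesis using False by (simp add: diameter_def)
    qed (use c diameter_ge_0[OF U(2)] in simp)
    have pow: "diam_pow s (f ` (U k \<inter> X)) \<le> ennreal (c powr s) * diam_pow s (U k)" for k
    proof (cases "U k \<inter> X = {}")
      case False
      have "diameter (f ` (U k \<inter> X)) powr s \<le> (c * diameter (U k)) powr s"
        by (intro powr_mono2 s diam diameter_ge_0 bd)
      also have "\<dots> = c powr s * diameter (U k) powr s"
        using c diameter_ge_0[OF U(2)[of k]] by (simp add: powr_mult)
      finally show ?thesis using False c
        by (auto simp: diam_pow_def simp flip: ennreal_mult intro: ennreal_leI)
    qed auto
    have "hausdorff_premeasure s d (f ` X) \<le> (\<Sum>k. diam_pow s (f ` (U k \<inter> X)))"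
    proof (rule hausdorff_premeasure_le)
      show "f ` X \<subseteq> (\<Union>k. f ` (U k \<inter> X))" using U(1) by blast
      show "diameter (f ` (U k \<inter> X)) \<le> d" for k
        using diam[of k] U(3)[of k] c by (simp add: pos_le_divide_eq mult.commute)
    qed (rule bd)
    also have "\<dots> \<le> (\<Sum>k. ennreal (c powr s) * diam_pow s (U k))"
      by (intro suminf_le pow) auto
    finally show "hausdorff_premeasure s d (f ` X) \<le> ennreal (c powr s) * (\<Sum>k. diam_pow s (U k))"
      by simp
  qed
  also have "\<dots> \<le> ennreal (c powr s) * hausdorff_outer s X"
    using c d by (intro mult_left_mono hausdorff_premeasure_le_outer) auto
  finally show "hausdorff_premeasure s d (f ` X) \<le> ennreal (c powr s) * hausdorff_outer s X" .
qed

lemma diam_pow_closure: "bounded U \<Longrightarrow> diam_pow s (closure U) = diam_pow s U"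
  by (simp add: diam_pow_def diameter_closure)

text \<open>
  The mass distribution principle: a measure which charges no small set with more than a constant
  times its diameter to the power \<open>s\<close> bounds the \<open>s\<close>-dimensional Hausdorff measure from below.
  The measure on the metric space is given as the image of \<open>M\<close> under \<open>f\<close>.
\<close>

lemma mass_distribution_principle:
  fixes f :: "'b \<Rightarrow> 'a :: metric_space"
  assumes f: "f \<in> borel_measurable M" and X: "f ` space M \<subseteq> X" and c: "0 < c" and r: "0 < r"
    and le: "\<And>U. closed U \<Longrightarrow> bounded U \<Longrightarrow> U \<noteq> {} \<Longrightarrow> diameter U \<le> r \<Longrightarrow>
                emeasure M (f -` U \<inter> space M) \<le> ennreal c * diam_pow s U"
  shows "emeasure M (space M) \<le> ennreal c * hausdorff_outer s X"
proof -
  have "emeasure M (space M) \<le> ennreal c * hausdorff_premeasure s r X"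
    unfolding ennreal_le_mult_iff[OF c]
  proof (rule hausdorff_premeasure_greatest, unfold ennreal_le_mult_iff[OF c, symmetric])
    fix U :: "nat \<Rightarrow> 'a set"
    assume U: "X \<subseteq> (\<Union>k. U k)" "\<And>k. bounded (U k)" "\<And>k. diameter (U k) \<le> r"
    have "emeasure M (space M) \<le> emeasure M (\<Union>k. f -` closure (U k) \<inter> space M)"
    proof (rule emeasure_mono)
      show "space M \<subseteq> (\<Union>k. f -` closure (U k) \<inter> space M)"
      proof
        fix x assume x: "x \<in> space M"
        hence "f x \<in> (\<Union>k. U k)" using X U(1) by auto
        then obtain k where "f x \<in> U k" by auto
        hence "f x \<in> closure (U k)" using closure_subset by auto
        thus "x \<in> (\<Union>k. f -` closure (U k) \<inter> space M)" using x by auto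
      qed
      show "(\<Union>k. f -` closure (U k) \<inter> space M) \<in> sets M"
        by (intro sets.countable_nat_UN) (auto intro!: measurable_sets[OF f])
    qed
    also have "\<dots> \<le> (\<Sum>k. emeasure M (f -` closure (U k) \<inter> space M))"
      by (rule emeasure_subadditive_countably) (use f in \<open>auto intro!: measurable_sets\<close>)
    also have "\<dots> \<le> (\<Sum>k. ennreal c * diam_pow s (U k))"
    proof (intro suminf_le)
      fix k
      show "emeasure M (f -` closure (U k) \<inter> space M) \<le> ennreal c * diam_pow s (U k)"
      proof (cases "U k = {}")
        case False
        thus ?thesis
          using le[of "closure (U k)"] U(2,3)[of k]
          by (simp add: diam_pow_closure diameter_closure bounded_closure)
      qed auto
    qed auto
    finally show "emeasure M (space M) \<le> ennreal c * (\<Sum>k. diam_pow s (U k))" by simp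
  qed
  also have "\<dots> \<le> ennreal c * hausdorff_outer s X"
    by (intro mult_left_mono hausdorff_premeasure_le_outer r) auto
  finally show ?thesis .
qed

lemma hausdorff_premeasure_finite_cover:
  assumes I: "finite I" and X: "X \<subseteq> (\<Union>i\<in>I. V i)" and d: "0 \<le> d"
    and V: "\<And>i. i \<in> I \<Longrightarrow> bounded (V i)" "\<And>i. i \<in> I \<Longrightarrow> diameter (V i) \<le> d"
      "\<And>i. i \<in> I \<Longrightarrow> diam_pow s (V i) \<le> c"
  shows "hausdorff_premeasure s d X \<le> of_nat (card I) * c"
proof -
  obtain g where g: "bij_betw g {..<card I} I"
    using bij_betw_from_nat_into_finite[OF I] by blast
  define U where "U k = (if k < card I then V (g k) else {})" for k
  have gI: "g k \<in> I" if "k < card I" for k using g that by (auto simp: bij_betw_def)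
  have "hausdorff_premeasure s d X \<le> (\<Sum>k. diam_pow s (U k))"
  proof (rule hausdorff_premeasure_le)
    have "X \<subseteq> (\<Union>i\<in>g ` {..<card I}. V i)"
      using X by (simp only: bij_betw_imp_surj_on[OF g])
    also have "\<dots> \<subseteq> (\<Union>k. U k)" by (auto simp: U_def)
    finally show "X \<subseteq> (\<Union>k. U k)" .
  qed (use V gI d in \<open>auto simp: U_def\<close>)
  also have "\<dots> = (\<Sum>k<card I. diam_pow s (U k))"
    by (rule suminf_finite) (auto simp: U_def)
  also have "\<dots> \<le> (\<Sum>k<card I. c)"
    by (intro sum_mono) (use V gI in \<open>auto simp: U_def\<close>)
  finally show ?thesis by simp
qed

lemma hausdorff_outer_2_unit_interval: "hausdorff_outer 2 {0..1::real} = 0"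
proof -
  have le: "hausdorff_premeasure 2 d {0..1::real} \<le> ennreal e" if d: "0 < d" and e: "0 < e" for d e :: real
  proof -
    obtain n where n: "1 / real (Suc n) < min d e" using d e by (metis min_less_iff_conj nat_approx_posE)
    define m where "m = Suc n"
    have m: "0 < m" "1 / real m \<le> d" "1 / real m \<le> e" using n by (auto simp: m_def)
    have "hausdorff_premeasure 2 d {0..1::real} \<le> of_nat (card {..<m}) * ennreal ((1 / real m) ^ 2)"
    proof (rule hausdorff_premeasure_finite_cover)
      show "{0..1} \<subseteq> (\<Union>i\<in>{..<m}. {real i / real m..real (Suc i) / real m})"
      proof
        fix x :: real assume x: "x \<in> {0..1}"
        show "x \<in> (\<Union>i\<in>{..<m}. {real i / real m..real (Suc i) / real m})"
        proof (cases "x = 1")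
          case True
          hence "x \<in> {real n / real m..real (Suc n) / real m}" by (simp add: m_def)
          moreover have "n \<in> {..<m}" by (simp add: m_def)
          ultimately show ?thesis by (rule UN_I[rotated])
        next
          case False
          define i where "i = nat \<lfloor>x * real m\<rfloor>"
          have i: "real i \<le> x * real m" "x * real m < real i + 1" using x by (auto simp: i_def)
          have "x < 1" using x False by auto
          hence "x * real m < 1 * real m" using m(1) by (intro mult_strict_right_mono) auto
          hence "x * real m < real m" by simp
          with i(1) have "real i < real m" by (rule le_less_trans)
          hence "i \<in> {..<m}" by simp
          moreover have "x \<in> {real i / real m..real (Suc i) / real m}"
            using i m(1) by (simp add: pos_divide_le_eq pos_le_divide_eq)
          ultimately show ?thesis by (rule UN_I)
        qed
      qed
      fix i
      have "\<not> real (Suc i) / real m < real i / real m"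
        by (intro leD divide_right_mono) auto
      hence diam: "diameter {real i / real m..real (Suc i) / real m} = 1 / real m"
        by (simp only: diameter_closed_interval if_False diff_divide_distrib[symmetric]) simp
      show "diameter {real i / real m..real (Suc i) / real m} \<le> d" unfolding diam by (rule m)
      show "diam_pow 2 {real i / real m..real (Suc i) / real m} \<le> ennreal ((1 / real m) ^ 2)"
        by (auto simp only: diam_pow_def diam powr_numeral intro!: ennreal_leI) simp_all
      show "bounded {real i / real m..real (Suc i) / real m}" by simp
    qed (use d in simp_all)
    also have "\<dots> = ennreal (real m * (1 / real m) ^ 2)"
      by (simp add: ennreal_mult ennreal_of_nat_eq_real_of_nat)
    also have "real m * (1 / real m) ^ 2 = 1 / real m" using m(1) by (simp add: power2_eq_square)
    also have "ennreal (1 / real m) \<le> ennreal e" by (rule ennreal_leI) (rule m)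
    finally show ?thesis .
  qed
  have "hausdorff_premeasure 2 d {0..1::real} \<le> 0" if "0 < d" for d
    by (rule ennreal_le_epsilon) (simp add: le that)
  hence "hausdorff_outer 2 {0..1::real} \<le> 0" by (rule hausdorff_outer_least)
  thus ?thesis by simp
qed

section \<open>Base N expansions\<close>

abbreviation digit_seqs :: "nat \<Rightarrow> (nat \<Rightarrow> nat) set" where
  "digit_seqs N \<equiv> {x. \<forall>k. x k < N}"

lemma shift_apply: "shift x k = x (Suc k)"
  by (simp add: shift_def)

lemma funpow_shift_apply: "(shift ^^ n) x k = x (n + k)"
  by (induction n arbitrary: x k) (auto simp: shift_apply funpow_swap1)

lemma shift_digit_seqs: "x \<in> digit_seqs N \<Longrightarrow> (shift ^^ n) x \<in> digit_seqs N"
  by (simp add: funpow_shift_apply)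

lemma geometric_digit_sums:
  assumes "2 \<le> N"
  shows "(\<lambda>k. (real N - 1) / real N ^ Suc k) sums 1"
proof -
  have "(\<lambda>k. (real N - 1) / real N * (1 / real N) ^ k) sums ((real N - 1) / real N * (1 / (1 - 1 / real N)))"
    using assms by (intro sums_mult geometric_sums) auto
  moreover have "(real N - 1) / real N * (1 / (1 - 1 / real N)) = 1"
    using assms by (simp add: field_simps)
  ultimately show ?thesis using assms by (simp only: power_divide power_one times_divide_times_eq mult_1_right power_Suc)
qed

lemma val_summable:
  assumes "2 \<le> N" "x \<in> digit_seqs N"
  shows "summable (\<lambda>k. real (x k) / real N ^ Suc k)"
proof (rule summable_comparison_test_ev[OF always_eventually])
  have "real (x k) \<le> real N - 1" for k
    using assms(2)[simplified, rule_format, of k] by linarith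
  thus "\<forall>k. norm (real (x k) / real N ^ Suc k) \<le> (real N - 1) / real N ^ Suc k"
    by (auto intro!: divide_right_mono)
  show "summable (\<lambda>k. (real N - 1) / real N ^ Suc k)"
    using geometric_digit_sums[OF assms(1)] by (rule sums_summable)
qed

lemma val_nonneg: "2 \<le> N \<Longrightarrow> x \<in> digit_seqs N \<Longrightarrow> 0 \<le> val N x"
  unfolding val_def by (intro suminf_nonneg val_summable) auto

lemma val_shift:
  assumes "2 \<le> N" "x \<in> digit_seqs N"
  shows "real N * val N x = real (x 0) + val N (shift x)"
proof -
  have "val N x = real (x 0) / real N + (\<Sum>k. real (x (Suc k)) / real N ^ Suc (Suc k))"
    using suminf_split_head[OF val_summable[OF assms]] by (simp add: val_def)
  also have "(\<Sum>k. real (x (Suc k)) / real N ^ Suc (Suc k))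
      = (\<Sum>k. (real (shift x k) / real N ^ Suc k) / real N)"
    by (simp add: shift_apply mult.commute)
  also have "\<dots> = val N (shift x) / real N"
    unfolding val_def by (rule suminf_divide) (use val_summable[OF assms(1), of "shift x"] assms(2) in \<open>auto simp: shift_apply\<close>)
  finally show ?thesis using assms(1) by (simp add: field_simps)
qed

text \<open>Digitwise complementation realises \<open>y \<mapsto> 1 - y\<close>.\<close>

definition complement_digits :: "nat \<Rightarrow> (nat \<Rightarrow> nat) \<Rightarrow> nat \<Rightarrow> nat" where
  "complement_digits N x k = N - 1 - x k"

lemma complement_digits_in:
  "2 \<le> N \<Longrightarrow> complement_digits N x \<in> digit_seqs N"
  by (simp add: complement_digits_def)

lemma complement_complement:
  assumes "x \<in> digit_seqs N"
  shows "complement_digits N (complement_digits N x) = x"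
proof
  fix k
  show "complement_digits N (complement_digits N x) k = x k"
    using assms[simplified, rule_format, of k] by (simp add: complement_digits_def)
qed

lemma val_complement:
  assumes "2 \<le> N" "x \<in> digit_seqs N"
  shows "val N (complement_digits N x) = 1 - val N x"
proof -
  have "real (x k) / real N ^ Suc k + real (complement_digits N x k) / real N ^ Suc k
          = (real N - 1) / real N ^ Suc k" for k
    using assms(2)[simplified, rule_format, of k]
    by (simp add: complement_digits_def add_divide_distrib[symmetric] of_nat_diff)
  hence "(\<lambda>k. real (x k) / real N ^ Suc k + real (complement_digits N x k) / real N ^ Suc k) sums 1"
    using geometric_digit_sums[OF assms(1)] by simp
  hence "val N x + val N (complement_digits N x) = 1"
    unfolding val_def
    by (subst suminf_add)
       (use assms complement_digits_in val_summable in \<open>auto dest: sums_unique\<close>)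
  thus ?thesis by simp
qed

lemma val_le_1: "2 \<le> N \<Longrightarrow> x \<in> digit_seqs N \<Longrightarrow> val N x \<le> 1"
  using val_nonneg[of N "complement_digits N x"] val_complement[of N x] complement_digits_in[of N x]
  by simp

lemma val_eq_0:
  assumes "2 \<le> N" "x \<in> digit_seqs N" "val N x = 0"
  shows "x k = 0"
proof -
  have "\<forall>k. real (x k) / real N ^ Suc k = 0"
    using suminf_eq_zero_iff[OF val_summable[OF assms(1,2)]] assms(3) by (simp add: val_def)
  thus ?thesis using assms(1) by (auto dest!: spec[of _ k])
qed

lemma val_eq_1:
  assumes "2 \<le> N" "x \<in> digit_seqs N" "val N x = 1"
  shows "x k = N - 1"
  using val_eq_0[OF assms(1) complement_digits_in[OF assms(1), of x], of k] val_complement[OF assms(1,2)]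
    assms(2)[simplified, rule_format, of k] assms(3)
  by (simp add: complement_digits_def)

text \<open>The integer whose base \<open>N\<close> digits are the first \<open>n\<close> letters of \<open>x\<close>.\<close>

primrec word_num :: "nat \<Rightarrow> (nat \<Rightarrow> nat) \<Rightarrow> nat \<Rightarrow> nat" where
  "word_num N x 0 = 0"
| "word_num N x (Suc n) = N * word_num N x n + x n"

lemma val_word_num:
  assumes "2 \<le> N" "x \<in> digit_seqs N"
  shows "real N ^ n * val N x = real (word_num N x n) + val N ((shift ^^ n) x)"
proof (induction n)
  case (Suc n)
  have "real N ^ Suc n * val N x = real N * (real N ^ n * val N x)" by simp
  also have "\<dots> = real N * real (word_num N x n) + real N * val N ((shift ^^ n) x)"
    by (simp add: Suc.IH distrib_left)
  also have "real N * val N ((shift ^^ n) x) = real (x n) + val N ((shift ^^ Suc n) x)"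
    using val_shift[OF assms(1) shift_digit_seqs[OF assms(2), of n]] by (simp add: funpow_shift_apply[of n x 0])
  finally show ?case by simp
qed simp

lemma word_num_inj:
  assumes "x \<in> digit_seqs N" "y \<in> digit_seqs N" "word_num N x n = word_num N y n" "j < n"
  shows "x j = y j"
  using assms(3,4)
proof (induction n)
  case (Suc n)
  have d: "x n < N" "y n < N" using assms by auto
  have eq: "N * word_num N x n + x n = N * word_num N y n + y n" using Suc.prems(1) by simp
  have "x n = y n" using arg_cong[OF eq, of "\<lambda>m. m mod N"] d by simp
  moreover have "word_num N x n = word_num N y n" using arg_cong[OF eq, of "\<lambda>m. m div N"] d by simp
  ultimately show ?case using Suc.IH Suc.prems(2) by (auto simp: less_Suc_eq)
qed simp

lemma word_num_cong: "(\<And>j. j < n \<Longrightarrow> x j = y j) \<Longrightarrow> word_num N x n = word_num N y n"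
  by (induction n) auto

lemma val_dist_le:
  assumes "2 \<le> N" "x \<in> digit_seqs N" "y \<in> digit_seqs N" "\<And>j. j < n \<Longrightarrow> x j = y j"
  shows "\<bar>val N x - val N y\<bar> \<le> (1 / real N) ^ n"
proof -
  have "real N ^ n * (val N x - val N y) = val N ((shift ^^ n) x) - val N ((shift ^^ n) y)"
    using val_word_num[OF assms(1,2), of n] val_word_num[OF assms(1,3), of n] word_num_cong[OF assms(4)]
    by (simp only: right_diff_distrib)
  also have "\<bar>\<dots>\<bar> \<le> 1"
    using val_nonneg[OF assms(1) shift_digit_seqs[OF assms(2), of n]] val_le_1[OF assms(1) shift_digit_seqs[OF assms(2), of n]]
      val_nonneg[OF assms(1) shift_digit_seqs[OF assms(3), of n]] val_le_1[OF assms(1) shift_digit_seqs[OF assms(3), of n]]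
    by auto
  finally have "real N ^ n * \<bar>val N x - val N y\<bar> \<le> 1" by (simp add: abs_mult)
  thus ?thesis using assms(1) by (simp add: power_divide field_simps)
qed

text \<open>
  The base \<open>N\<close> expansion of a real number \<open>y\<close> with \<open>0 \<le> y < 1\<close>, generated by the map \<open>y \<mapsto> N y mod 1\<close>.
  If \<open>y\<close> has two expansions, this is the terminating one.
\<close>

definition digit_map :: "nat \<Rightarrow> real \<Rightarrow> real" where
  "digit_map N y = frac (real N * y)"

definition digits :: "nat \<Rightarrow> real \<Rightarrow> nat \<Rightarrow> nat" where
  "digits N y k = nat \<lfloor>real N * (digit_map N ^^ k) y\<rfloor>"

lemma digit_map_range: "0 \<le> y \<Longrightarrow> y < 1 \<Longrightarrow> 0 \<le> (digit_map N ^^ k) y \<and> (digit_map N ^^ k) y < 1"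
  by (induction k) (auto simp: digit_map_def frac_lt_1)

lemma digits_less:
  assumes "0 < N" "0 \<le> y" "y < 1"
  shows "digits N y k < N"
proof -
  have "real N * (digit_map N ^^ k) y < real N * 1"
    using digit_map_range[OF assms(2,3)] assms(1) by (intro mult_strict_left_mono) auto
  thus ?thesis
    using digit_map_range[OF assms(2,3), of k N] assms(1) by (simp add: digits_def nat_less_iff floor_less_iff)
qed

lemma word_num_digits:
  assumes "0 \<le> y" "y < 1"
  shows "real N ^ k * y = real (word_num N (digits N y) k) + (digit_map N ^^ k) y"
proof (induction k)
  case (Suc k)
  have "real N ^ Suc k * y = real N * real (word_num N (digits N y) k) + real N * (digit_map N ^^ k) y"
    using Suc.IH by (simp add: distrib_left mult.assoc)
  also have "real N * (digit_map N ^^ k) y = real (digits N y k) + (digit_map N ^^ Suc k) y"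
    using digit_map_range[OF assms, of k N]
    by (simp add: digits_def digit_map_def[of N "(digit_map N ^^ k) y"] frac_def)
  finally show ?case by simp
qed simp

lemma digits_val:
  assumes "2 \<le> N" "x \<in> digit_seqs N" "\<And>k. val N ((shift ^^ k) x) \<noteq> 1"
  shows "digits N (val N x) = x"
proof -
  have less: "val N ((shift ^^ k) x) < 1" for k
    using val_le_1[OF assms(1) shift_digit_seqs[OF assms(2)], of k] assms(3)[of k] by simp
  have step: "real N * val N ((shift ^^ k) x) = real (x k) + val N ((shift ^^ Suc k) x)" for k
    using val_shift[OF assms(1) shift_digit_seqs[OF assms(2)], of k] by (simp add: funpow_shift_apply[of k x 0])
  have nonneg: "0 \<le> val N ((shift ^^ k) x)" for k
    by (rule val_nonneg[OF assms(1) shift_digit_seqs[OF assms(2)]])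
  have fl: "\<lfloor>real N * val N ((shift ^^ k) x)\<rfloor> = int (x k)" for k
    unfolding step using less[of "Suc k"] nonneg[of "Suc k"] by (intro floor_unique) auto
  have "(digit_map N ^^ k) (val N x) = val N ((shift ^^ k) x)" for k
  proof (induction k)
    case (Suc k)
    hence "(digit_map N ^^ Suc k) (val N x) = frac (real N * val N ((shift ^^ k) x))"
      by (simp add: digit_map_def[of N "val N ((shift ^^ k) x)"])
    also have "\<dots> = val N ((shift ^^ Suc k) x)" using fl[of k] step[of k] by (simp only: frac_def)
    finally show ?case .
  qed simp
  thus ?thesis using fl by (auto simp: digits_def fun_eq_iff)
qed

lemma borel_measurable_digit_map [measurable]: "(digit_map N ^^ k) \<in> borel_measurable borel"
proof (induction k)
  case (Suc k)
  have "(\<lambda>y. frac (real N * (digit_map N ^^ k) y)) \<in> borel_measurable borel"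
    using Suc unfolding frac_def by measurable
  thus ?case by (simp add: digit_map_def[abs_def] comp_def)
qed simp

lemma measurable_borel_nat: "measurable M (borel :: nat measure) = measurable M (count_space UNIV)"
  by (rule measurable_cong_sets) (simp_all add: sets_borel_eq_count_space)

lemma borel_measurable_seqI:
  assumes "\<And>k. (\<lambda>x. f x k) \<in> measurable M (count_space UNIV)"
  shows "(f :: 'a \<Rightarrow> nat \<Rightarrow> nat) \<in> borel_measurable M"
  by (rule measurable_coordinatewise_then_product) (use assms in \<open>simp add: measurable_borel_nat\<close>)

lemma borel_measurable_digits: "digits N \<in> borel_measurable borel"
proof (rule borel_measurable_seqI)
  fix k
  show "(\<lambda>y. digits N y k) \<in> measurable borel (count_space UNIV)"
    unfolding digits_def by measurable
qed

lemma measurable_letter: "(\<lambda>x :: nat \<Rightarrow> nat. x k) \<in> measurable borel (count_space UNIV)"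
  unfolding measurable_borel_nat[symmetric] by simp

lemma sets_letter: "{x :: nat \<Rightarrow> nat. P (x k)} \<in> sets borel"
  using measurable_sets[OF measurable_letter[of k], of "{n. P n}"] by (simp add: vimage_def)

lemma borel_measurable_val [measurable]: "val N \<in> borel_measurable borel"
proof -
  have [measurable]: "(\<lambda>x :: nat \<Rightarrow> nat. real (x k)) \<in> borel_measurable borel" for k
    by (rule measurable_compose[OF measurable_letter]) simp
  show ?thesis unfolding val_def by measurable
qed

lemma borel_measurable_complement [measurable]: "complement_digits N \<in> borel_measurable borel"
  by (rule borel_measurable_seqI)
     (auto simp: complement_digits_def intro!: measurable_compose[OF measurable_letter])

lemma borel_measurable_shift [measurable]: "shift \<in> borel_measurable borel"
  by (rule borel_measurable_seqI) (simp add: shift_apply measurable_letter)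

lemma borel_measurable_prefix [measurable]: "prefix i \<in> borel_measurable borel"
proof (rule borel_measurable_seqI)
  fix k show "(\<lambda>x. prefix i x k) \<in> measurable borel (count_space UNIV)"
    by (cases k) (simp_all add: prefix_def measurable_letter)
qed

text \<open>
  The fibres of \<open>val\<close> have at most two points: one expansion that does not end in the digit \<open>N - 1\<close>,
  which is the one produced by \<open>digits\<close>, and one that does, whose complement is an expansion of
  \<open>1 - y\<close> of the first kind. Both points depend measurably on \<open>y\<close>. The set \<open>top_tails N\<close> consists of
  the sequences which are eventually constant with value \<open>N - 1\<close>.
\<close>

definition top_tails :: "nat \<Rightarrow> (nat \<Rightarrow> nat) set" where
  "top_tails N = {x. \<exists>n. \<forall>k. x (n + k) = N - 1}"

lemma sets_top_tails [measurable]: "top_tails N \<in> sets borel"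
proof -
  have "top_tails N = (\<Union>n. \<Inter>k. {x. x (n + k) = N - 1})" by (auto simp: top_tails_def)
  also have "\<dots> \<in> sets borel" by (intro sets.countable_UN'' sets.countable_INT'' sets_letter) auto
  finally show ?thesis .
qed

lemma digits_val_not_top:
  assumes "2 \<le> N" "x \<in> digit_seqs N" "x \<notin> top_tails N"
  shows "digits N (val N x) = x"
proof (rule digits_val[OF assms(1,2)])
  fix k
  show "val N ((shift ^^ k) x) \<noteq> 1"
  proof
    assume "val N ((shift ^^ k) x) = 1"
    hence "\<forall>j. (shift ^^ k) x j = N - 1"
      using val_eq_1[OF assms(1) shift_digit_seqs[OF assms(2)]] by blast
    thus False using assms(3) by (auto simp: top_tails_def funpow_shift_apply)
  qed
qed

lemma digits_val_top:
  assumes "2 \<le> N" "x \<in> digit_seqs N" "x \<in> top_tails N"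
  shows "complement_digits N (digits N (1 - val N x)) = x"
proof -
  obtain n where n: "\<And>k. x (n + k) = N - 1" using assms(3) by (auto simp: top_tails_def)
  have "complement_digits N x \<notin> top_tails N"
  proof
    assume "complement_digits N x \<in> top_tails N"
    then obtain m where "\<And>k. complement_digits N x (m + k) = N - 1" by (auto simp: top_tails_def)
    from this[of n] n[of m] assms(1) show False by (simp add: complement_digits_def add.commute)
  qed
  hence "digits N (1 - val N x) = complement_digits N x"
    using digits_val_not_top[OF assms(1) complement_digits_in[OF assms(1), of x]]
    by (simp add: val_complement[OF assms(1,2)])
  thus ?thesis by (simp add: complement_complement[OF assms(2)])
qed

text \<open>The number of expansions of \<open>y\<close> in the set \<open>B\<close>, the integrand in the definition of \<open>muA\<close>.\<close>

definition fibre_count :: "nat \<Rightarrow> (nat \<Rightarrow> nat) set \<Rightarrow> real \<Rightarrow> ennreal" where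
  "fibre_count N B y = emeasure (count_space UNIV) {w \<in> B. val N w = y}"

lemma fibre_count_eq:
  assumes "2 \<le> N" "B \<subseteq> digit_seqs N"
  shows "fibre_count N B y =
           indicator ((B - top_tails N) \<inter> {w. val N w = y}) (digits N y) +
           indicator ((B \<inter> top_tails N) \<inter> {w. val N w = y}) (complement_digits N (digits N (1 - y)))"
    (is "_ = indicator ?P ?p + indicator ?Q ?q")
proof -
  have P: "?P \<subseteq> {?p}"
  proof
    fix w assume w: "w \<in> ?P"
    hence "digits N (val N w) = w" using assms by (intro digits_val_not_top) auto
    thus "w \<in> {?p}" using w by simp
  qed
  have Q: "?Q \<subseteq> {?q}"
  proof
    fix w assume w: "w \<in> ?Q"
    hence "complement_digits N (digits N (1 - val N w)) = w" using assms by (intro digits_val_top) auto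
    thus "w \<in> {?q}" using w by simp
  qed
  have "{w \<in> B. val N w = y} = ?P \<union> ?Q" by auto
  hence "fibre_count N B y = emeasure (count_space UNIV) ?P + emeasure (count_space UNIV) ?Q"
    by (auto simp: fibre_count_def intro!: plus_emeasure[symmetric])
  moreover have single: "emeasure (count_space UNIV) Z = indicator Z z" if "Z \<subseteq> {z}" for Z and z :: "nat \<Rightarrow> nat"
    using that by (auto simp: subset_singleton_iff)
  ultimately show ?thesis using single[OF P] single[OF Q] by simp
qed

lemma fibre_count_le_2:
  assumes "2 \<le> N" "B \<subseteq> digit_seqs N"
  shows "fibre_count N B y \<le> 2"
  unfolding fibre_count_eq[OF assms] by (auto simp: indicator_def)

lemma borel_measurable_fibre_count:
  assumes "2 \<le> N" "B \<subseteq> digit_seqs N" "B \<in> sets borel"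
  shows "fibre_count N B \<in> borel_measurable borel"
proof -
  define p where "p = digits N"
  define q where "q y = complement_digits N (digits N (1 - y))" for y
  define P where "P = B - top_tails N"
  define Q where "Q = B \<inter> top_tails N"
  note [measurable] = borel_measurable_digits
  have [measurable]: "p \<in> borel_measurable borel" "q \<in> borel_measurable borel"
    unfolding p_def q_def by measurable
  have [measurable]: "P \<in> sets borel" "Q \<in> sets borel"
    unfolding P_def Q_def using assms(3) sets_top_tails by auto
  have "fibre_count N B = (\<lambda>y. (if p y \<in> P \<and> val N (p y) = y then 1 else 0) +
     (if q y \<in> Q \<and> val N (q y) = y then 1 else 0))"
    using fibre_count_eq[OF assms(1,2)] by (auto simp: fun_eq_iff indicator_def p_def q_def P_def Q_def)
  also have "\<dots> \<in> borel_measurable borel" by measurable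
  finally show ?thesis .
qed

section \<open>The measure on the sequence space\<close>

lemma hausdorff_outer_affine_vimage:
  fixes b c :: real
  assumes s: "0 \<le> s" and c: "0 < c"
  shows "hausdorff_outer s ((\<lambda>y. c * y + b) -` B) = ennreal (c powr - s) * hausdorff_outer s B"
    (is "hausdorff_outer s (?f -` B) = _")
proof (rule antisym)
  have eq: "?f -` B = (\<lambda>z. (z - b) / c) ` B"
  proof safe
    fix y assume "c * y + b \<in> B"
    thus "y \<in> (\<lambda>z. (z - b) / c) ` B" using c by (auto intro!: image_eqI[of _ _ "c * y + b"])
  qed (use c in auto)
  have "hausdorff_outer s ((\<lambda>z. (z - b) / c) ` B) \<le> ennreal ((1 / c) powr s) * hausdorff_outer s B"
  proof (rule hausdorff_outer_lipschitz_le[OF s])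
    fix x y :: real
    have "(x - b) / c - (y - b) / c = (1 / c) * (x - y)" by (simp add: diff_divide_distrib)
    thus "dist ((x - b) / c) ((y - b) / c) \<le> 1 / c * dist x y"
      using c by (simp add: dist_real_def abs_mult)
  qed (use c in auto)
  thus "hausdorff_outer s (?f -` B) \<le> ennreal (c powr - s) * hausdorff_outer s B"
    using c by (simp add: eq powr_divide powr_minus_divide)
  have "hausdorff_outer s (?f ` (?f -` B)) \<le> ennreal (c powr s) * hausdorff_outer s (?f -` B)"
  proof (rule hausdorff_outer_lipschitz_le[OF s c])
    fix x y :: real
    have "(c * x + b) - (c * y + b) = c * (x - y)" by (simp add: right_diff_distrib)
    thus "dist (c * x + b) (c * y + b) \<le> c * dist x y" using c by (simp add: dist_real_def abs_mult)
  qed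
  moreover have "?f ` (?f -` B) = B"
    using c by (auto intro!: image_eqI[of _ _ "(_ - b) / c"])
  ultimately have "hausdorff_outer s B \<le> ennreal (c powr s) * hausdorff_outer s (?f -` B)" by simp
  hence "ennreal (1 / c powr s) * hausdorff_outer s B \<le> hausdorff_outer s (?f -` B)"
    using c by (subst (asm) ennreal_le_mult_iff) auto
  thus "ennreal (c powr - s) * hausdorff_outer s B \<le> hausdorff_outer s (?f -` B)"
    by (simp add: powr_minus_divide)
qed

lemma nn_integral_hausdorff_affine:
  fixes b c :: real
  assumes s: "0 \<le> s" and c: "0 < c" and g [measurable]: "g \<in> borel_measurable borel"
  shows "(\<integral>\<^sup>+y. g (c * y + b) \<partial>hausdorff_measure s)
           = ennreal (c powr - s) * (\<integral>\<^sup>+y. g y \<partial>hausdorff_measure s)"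
proof -
  let ?H = "hausdorff_measure s :: real measure" and ?f = "\<lambda>y. c * y + b"
  have f: "?f \<in> measurable ?H borel" by measurable
  have "distr ?H borel ?f = density ?H (\<lambda>_. ennreal (c powr - s))"
  proof (rule measure_eqI)
    fix B assume "B \<in> sets (distr ?H borel ?f)"
    hence B: "B \<in> sets borel" by simp
    have "?f -` B \<in> sets borel" using measurable_sets[OF f B] by simp
    thus "emeasure (distr ?H borel ?f) B = emeasure (density ?H (\<lambda>_. ennreal (c powr - s))) B"
      using B f s c by (simp add: emeasure_distr emeasure_density_const emeasure_hausdorff_measure
          hausdorff_outer_affine_vimage)
  qed simp
  moreover have "(\<integral>\<^sup>+y. g (c * y + b) \<partial>?H) = (\<integral>\<^sup>+y. g y \<partial>distr ?H borel ?f)"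
    using f by (simp add: nn_integral_distr)
  moreover have "(\<integral>\<^sup>+y. g y \<partial>density ?H (\<lambda>_. ennreal (c powr - s)))
                   = (\<integral>\<^sup>+y. ennreal (c powr - s) * g y \<partial>?H)"
    by (rule nn_integral_density) measurable
  ultimately show ?thesis by (simp add: nn_integral_cmult)
qed

lemma Lam_digit_seqs: "Lam N A \<subseteq> digit_seqs N"
  by (auto simp: Lam_def)

lemma sets_Lam: "Lam N A \<in> sets borel"
proof -
  have "Lam N A = (\<Inter>k. {x. x k < N}) \<inter> (\<Inter>k. \<Union>a. {x. x k = a} \<inter> {x. A a (x (Suc k)) = 1})"
    by (auto simp: Lam_def)
  also have "\<dots> \<in> sets borel"
    by (intro sets.Int sets.countable_UN'' sets.countable_INT'' sets_letter) auto
  finally show ?thesis .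
qed

lemma sets_muA: "sets (muA N A) = sets (restrict_space borel (Lam N A))"
  using sets.sigma_sets_eq[of "restrict_space borel (Lam N A)"] sets.space_closed[of "restrict_space borel (Lam N A)"]
  by (simp add: muA_def space_restrict_space)

lemma space_muA [simp]: "space (muA N A) = Lam N A"
  using sets_eq_imp_space_eq[OF sets_muA] by (simp add: space_restrict_space)

lemma sets_muA_iff: "B \<in> sets (muA N A) \<longleftrightarrow> B \<subseteq> Lam N A \<and> B \<in> sets borel"
  by (simp add: sets_muA sets_restrict_space_iff sets_Lam)

lemma sets_muA_subset: "B \<in> sets (muA N A) \<Longrightarrow> B \<subseteq> Lam N A"
  by (simp add: sets_muA_iff)

lemma sets_muA_digit_seqs: "B \<in> sets (muA N A) \<Longrightarrow> B \<subseteq> digit_seqs N"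
  by (rule order_trans[OF sets_muA_subset Lam_digit_seqs])

lemma sets_muA_borel: "B \<in> sets (muA N A) \<Longrightarrow> B \<in> sets borel"
  by (simp add: sets_muA_iff)

lemma measurable_muA: "f \<in> measurable borel M \<Longrightarrow> f \<in> measurable (muA N A) M"
  using measurable_restrict_space1[of f borel M "Lam N A"] measurable_cong_sets[OF sets_muA refl] by blast

lemma dimA_nonneg: "0 \<le> dimA N A"
  by (simp add: dimA_def)

lemma emeasure_muA:
  assumes N: "2 \<le> N" and B: "B \<in> sets (muA N A)"
  shows "emeasure (muA N A) B = (\<integral>\<^sup>+y. fibre_count N B y \<partial>hausdorff_measure (dimA N A))"
proof -
  let ?H = "hausdorff_measure (dimA N A) :: real measure"
  let ?\<nu> = "\<lambda>B. \<integral>\<^sup>+ y \<in> {0..1}. emeasure (count_space UNIV) {w \<in> B. val N w = y} \<partial>?H"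
  have \<nu>: "?\<nu> B = (\<integral>\<^sup>+y. fibre_count N B y \<partial>?H)" if "B \<in> sets (muA N A)" for B
  proof (rule nn_integral_cong)
    fix y :: real
    note digits = sets_muA_digit_seqs[OF that]
    have "y \<in> {0..1}" if "w \<in> B" "val N w = y" for w
      using that(2) val_nonneg[OF N subsetD[OF digits that(1)]] val_le_1[OF N subsetD[OF digits that(1)]]
      by simp
    hence empty: "{w \<in> B. val N w = y} = {}" if "y \<notin> {0..1}"
      using that by blast
    show "emeasure (count_space UNIV) {w \<in> B. val N w = y} * indicator {0..1} y = fibre_count N B y"
    proof (cases "y \<in> {0..1}")
      case False
      show ?thesis unfolding fibre_count_def empty[OF False] by simp
    qed (simp add: fibre_count_def)
  qed
  have "emeasure (muA N A) B = ?\<nu> B"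
    unfolding muA_def
  proof (rule emeasure_measure_of_sigma)
    show "sigma_algebra (Lam N A) (sets (restrict_space borel (Lam N A)))"
      using sets.sigma_algebra_axioms[of "restrict_space borel (Lam N A)"] by (simp add: space_restrict_space)
    show "positive (sets (restrict_space borel (Lam N A))) ?\<nu>"
      by (simp add: positive_def)
    show "countably_additive (sets (restrict_space borel (Lam N A))) ?\<nu>"
      unfolding countably_additive_def sets_muA[symmetric]
    proof (intro allI impI)
      fix X :: "nat \<Rightarrow> (nat \<Rightarrow> nat) set"
      assume X: "range X \<subseteq> sets (muA N A)" "disjoint_family X" "(\<Union>i. X i) \<in> sets (muA N A)"
      have "(\<Sum>i. ?\<nu> (X i)) = (\<Sum>i. \<integral>\<^sup>+y. fibre_count N (X i) y \<partial>?H)"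
        using X(1) \<nu> by (simp add: range_subsetD)
      also have "\<dots> = (\<integral>\<^sup>+y. (\<Sum>i. fibre_count N (X i) y) \<partial>?H)"
      proof (rule nn_integral_suminf[symmetric])
        fix i
        have "X i \<in> sets (muA N A)" using X(1) by auto
        thus "fibre_count N (X i) \<in> borel_measurable ?H"
          using borel_measurable_fibre_count[OF N sets_muA_digit_seqs sets_muA_borel] by simp
      qed
      also have "(\<lambda>y. \<Sum>i. fibre_count N (X i) y) = fibre_count N (\<Union>i. X i)"
      proof
        fix y
        have "(\<Sum>i. fibre_count N (X i) y)
                = emeasure (count_space UNIV) (\<Union>i. {w \<in> X i. val N w = y})"
          unfolding fibre_count_def
          by (rule suminf_emeasure) (use X(2) in \<open>auto simp: disjoint_family_on_def\<close>)
        also have "(\<Union>i. {w \<in> X i. val N w = y}) = {w \<in> (\<Union>i. X i). val N w = y}" by auto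
        finally show "(\<Sum>i. fibre_count N (X i) y) = fibre_count N (\<Union>i. X i) y"
          by (simp add: fibre_count_def)
      qed
      also have "integral\<^sup>N ?H (fibre_count N (\<Union>i. X i)) = ?\<nu> (\<Union>i. X i)"
        by (rule \<nu>[OF X(3), symmetric])
      finally show "(\<Sum>i. ?\<nu> (X i)) = ?\<nu> (\<Union>i. X i)" .
    qed
    show "B \<in> sets (restrict_space borel (Lam N A))" using B by (simp add: sets_muA)
  qed
  thus ?thesis using \<nu>[OF B] by simp
qed

text \<open>The counting function is at most two on \<open>val ` B\<close> and vanishes elsewhere.\<close>

lemma emeasure_muA_le:
  assumes N: "2 \<le> N" and B: "B \<in> sets (muA N A)"
  shows "emeasure (muA N A) B \<le> 2 * hausdorff_outer (dimA N A) (val N ` B)"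
proof -
  let ?H = "hausdorff_measure (dimA N A) :: real measure"
  have digits: "B \<subseteq> digit_seqs N" "B \<in> sets borel"
    using B sets_muA_digit_seqs sets_muA_borel by auto
  note [measurable] = borel_measurable_fibre_count[OF N digits]
  have img: "val N ` B = {y \<in> space borel. fibre_count N B y \<noteq> 0}"
    by (auto simp: fibre_count_def emeasure_count_space_eq_0 image_iff)
  have "val N ` B \<in> sets borel" unfolding img by measurable
  moreover have "emeasure (muA N A) B \<le> (\<integral>\<^sup>+y. 2 * indicator (val N ` B) y \<partial>?H)"
    unfolding emeasure_muA[OF assms]
  proof (rule nn_integral_mono)
    fix y
    show "fibre_count N B y \<le> 2 * indicator (val N ` B) y"
      using fibre_count_le_2[OF N digits(1), of y] by (auto simp: img indicator_def)
  qed
  ultimately show ?thesis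
    using emeasure_hausdorff_measure[OF dimA_nonneg, of "val N ` B" N A]
    by (simp add: nn_integral_cmult_indicator)
qed

lemma shift_prefix [simp]: "shift (prefix i x) = x"
  by (auto simp: shift_def prefix_def)

lemma prefix_shift: "x 0 = i \<Longrightarrow> prefix i (shift x) = x"
  by (auto simp: shift_def prefix_def fun_eq_iff split: nat.split)

lemma prefix_0 [simp]: "prefix i x 0 = i"
  by (simp add: prefix_def)

lemma inj_prefix: "inj (prefix i)"
  by (rule inj_on_inverseI[of _ shift]) simp

lemma prefix_image_eq: "prefix i ` B = {x. x 0 = i} \<inter> shift -` B"
proof safe
  fix x assume "shift x \<in> B" "i = x 0"
  thus "x \<in> prefix (x 0) ` B" by (intro image_eqI[of _ _ "shift x"]) (simp_all add: prefix_shift)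
qed simp_all

lemma prefix_in_Rset:
  assumes "i < N" "x \<in> Dset N A i"
  shows "prefix i x \<in> Rset N A i"
proof -
  have "prefix i x k < N \<and> A (prefix i x k) (prefix i x (Suc k)) = 1" for k
    using assms by (cases k) (auto simp: Dset_def Lam_def prefix_def)
  thus ?thesis by (auto simp: Rset_def Lam_def)
qed

lemma shift_in_Lam: "x \<in> Lam N A \<Longrightarrow> shift x \<in> Lam N A"
  by (auto simp: Lam_def shift_def)

lemma shift_in_Dset: "x \<in> Rset N A i \<Longrightarrow> shift x \<in> Dset N A i"
  by (auto simp: Lam_def Rset_def Dset_def shift_def)

lemma Dset_subset: "Dset N A i \<subseteq> Lam N A"
  by (auto simp: Dset_def)

lemma Rset_subset: "Rset N A i \<subseteq> Lam N A"
  by (auto simp: Rset_def)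

lemma sets_Dset: "Dset N A i \<in> sets (muA N A)"
proof -
  have "Dset N A i = Lam N A \<inter> {x. A i (x 0) = 1}" by (auto simp: Dset_def)
  thus ?thesis using sets_Lam sets_letter Dset_subset by (auto simp: sets_muA_iff)
qed

lemma sets_Rset: "Rset N A i \<in> sets (muA N A)"
proof -
  have "Rset N A i = Lam N A \<inter> {x. x 0 = i}" by (auto simp: Rset_def)
  thus ?thesis using sets_Lam sets_letter Rset_subset by (auto simp: sets_muA_iff)
qed

lemma Dset_Int_Lam [simp]: "Dset N A i \<inter> Lam N A = Dset N A i"
  using Dset_subset by auto

lemma Rset_Int_Lam [simp]: "Rset N A i \<inter> Lam N A = Rset N A i"
  using Rset_subset by auto

lemma sets_restrict_Dset:
  "B \<in> sets (restrict_space (muA N A) (Dset N A i)) \<longleftrightarrow> B \<subseteq> Dset N A i \<and> B \<in> sets (muA N A)"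
  by (rule sets_restrict_space_iff) (simp add: sets_Dset)

lemma sets_restrict_Rset:
  "B \<in> sets (restrict_space (muA N A) (Rset N A i)) \<longleftrightarrow> B \<subseteq> Rset N A i \<and> B \<in> sets (muA N A)"
  by (rule sets_restrict_space_iff) (simp add: sets_Rset)

lemma sets_prefix_image:
  assumes "i < N" "B \<in> sets (muA N A)" "B \<subseteq> Dset N A i"
  shows "prefix i ` B \<in> sets (muA N A)"
proof -
  have "prefix i ` B \<subseteq> Rset N A i" using prefix_in_Rset[OF assms(1)] assms(3) by auto
  moreover have "prefix i ` B \<in> sets borel"
    unfolding prefix_image_eq
    using measurable_sets[OF borel_measurable_shift, of B] sets_letter[of "\<lambda>n. n = i" 0] assms(2)
    by (auto simp: sets_muA_iff)
  ultimately show ?thesis using Rset_subset[of N A i] unfolding sets_muA_iff by (meson order_trans)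
qed

text \<open>
  A point of \<open>prefix i ` B\<close> has value \<open>y\<close> iff the corresponding point of \<open>B\<close> has value \<open>N y - i\<close>, so the
  scaling of Hausdorff measure on the line carries over with multiplicities.
\<close>

lemma emeasure_prefix_image:
  assumes N: "2 \<le> N" and i: "i < N" and B: "B \<in> sets (muA N A)" "B \<subseteq> Dset N A i"
  shows "emeasure (muA N A) (prefix i ` B) = ennreal (real N powr - dimA N A) * emeasure (muA N A) B"
proof -
  have digits: "B \<subseteq> digit_seqs N" "B \<in> sets borel"
    using B sets_muA_digit_seqs sets_muA_borel by auto
  have "fibre_count N (prefix i ` B) y = fibre_count N B (real N * y + - real i)" for y
  proof -
    have "val N (prefix i w) = y \<longleftrightarrow> val N w = real N * y + - real i" if w: "w \<in> B" for w
    proof -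
      have "prefix i w \<in> digit_seqs N"
        using i w digits(1) by (auto simp: prefix_def split: nat.split)
      from val_shift[OF N this] have "real N * val N (prefix i w) = real i + val N w" by simp
      moreover have "val N (prefix i w) = y \<longleftrightarrow> real N * val N (prefix i w) = real N * y" using N by simp
      ultimately show ?thesis by auto
    qed
    hence "{x \<in> prefix i ` B. val N x = y} = prefix i ` {w \<in> B. val N w = real N * y + - real i}"
      by auto
    moreover have "emeasure (count_space UNIV) (prefix i ` Z) = emeasure (count_space UNIV) Z" for Z
      using inj_on_subset[OF inj_prefix[of i]]
      by (cases "finite Z") (auto simp: card_image finite_image_iff)
    ultimately show ?thesis by (simp add: fibre_count_def)
  qed
  thus ?thesis
    using nn_integral_hausdorff_affine[OF dimA_nonneg, of "real N" "fibre_count N B" N A "- real i"]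
      borel_measurable_fibre_count[OF N digits] N
    by (simp add: emeasure_muA[OF N] B(1) sets_prefix_image[OF i B])
qed

lemma measurable_prefix:
  assumes "i < N"
  shows "prefix i \<in> measurable (restrict_space (muA N A) (Dset N A i)) (restrict_space (muA N A) (Rset N A i))"
proof (rule measurable_restrict_space2)
  show "prefix i \<in> space (restrict_space (muA N A) (Dset N A i)) \<rightarrow> Rset N A i"
    using prefix_in_Rset[OF assms] by (auto simp: space_restrict_space)
  have "prefix i \<in> measurable (restrict_space (muA N A) (Dset N A i)) (restrict_space borel (Lam N A))"
  proof (rule measurable_restrict_space2)
    show "prefix i \<in> space (restrict_space (muA N A) (Dset N A i)) \<rightarrow> Lam N A"
      using prefix_in_Rset[OF assms, of _ A] Rset_subset[of N A i] by (auto simp: space_restrict_space)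
  qed (intro measurable_restrict_space1 measurable_muA borel_measurable_prefix)
  thus "prefix i \<in> measurable (restrict_space (muA N A) (Dset N A i)) (muA N A)"
    using measurable_cong_sets[OF refl sets_muA] by blast
qed

text \<open>
  Changing variables along \<open>x \<mapsto> i x\<close>, the measure on \<open>Rset N A i\<close> is a multiple of the image of
  the measure on \<open>Dset N A i\<close>.
\<close>

lemma restrict_Rset_eq:
  assumes N: "2 \<le> N" and i: "i < N"
  shows "restrict_space (muA N A) (Rset N A i) =
    density (distr (restrict_space (muA N A) (Dset N A i)) (restrict_space (muA N A) (Rset N A i)) (prefix i))
      (\<lambda>_. ennreal (real N powr - dimA N A))"
proof (rule measure_eqI)
  fix B assume "B \<in> sets (restrict_space (muA N A) (Rset N A i))"
  hence B: "B \<in> sets (muA N A)" "B \<subseteq> Rset N A i" "B \<in> sets (restrict_space (muA N A) (Rset N A i))"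
    by (auto simp: sets_restrict_Rset)
  define C where "C = prefix i -` B \<inter> Dset N A i"
  have "C \<in> sets (restrict_space (muA N A) (Dset N A i))"
    using measurable_sets[OF measurable_prefix[OF i, of A] B(3)] Dset_subset[of N A i]
    by (simp add: C_def space_restrict_space Int_absorb1)
  hence C: "C \<in> sets (muA N A)" "C \<subseteq> Dset N A i"
    by (auto simp: sets_restrict_Dset)
  have "prefix i ` C = B"
  proof
    show "B \<subseteq> prefix i ` C"
    proof
      fix x assume x: "x \<in> B"
      hence "prefix i (shift x) = x" using B(2) by (intro prefix_shift) (auto simp: Rset_def)
      moreover have "shift x \<in> Dset N A i" using x B(2) by (auto intro: shift_in_Dset)
      ultimately show "x \<in> prefix i ` C" using x by (intro image_eqI[of _ _ "shift x"]) (auto simp: C_def)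
    qed
  qed (auto simp: C_def)
  hence "emeasure (muA N A) B = ennreal (real N powr - dimA N A) * emeasure (muA N A) C"
    using emeasure_prefix_image[OF N i C] by simp
  moreover have "emeasure (restrict_space (muA N A) (Dset N A i)) C = emeasure (muA N A) C"
    using C(2) by (intro emeasure_restrict_space) (simp_all add: sets_Dset)
  moreover have "emeasure (restrict_space (muA N A) (Rset N A i)) B = emeasure (muA N A) B"
    using B(2) by (intro emeasure_restrict_space) (simp_all add: sets_Rset)
  ultimately show "emeasure (restrict_space (muA N A) (Rset N A i)) B =
    emeasure (density (distr (restrict_space (muA N A) (Dset N A i)) (restrict_space (muA N A) (Rset N A i)) (prefix i))
      (\<lambda>_. ennreal (real N powr - dimA N A))) B"
    using B(3) Dset_subset[of N A i]
    by (simp add: emeasure_density_const emeasure_distr measurable_prefix[OF i] space_restrict_space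
        C_def Int_absorb1)
qed simp

lemma nn_integral_restrict_Rset:
  assumes N: "2 \<le> N" and i: "i < N"
    and f: "f \<in> borel_measurable (restrict_space (muA N A) (Rset N A i))"
  shows "(\<integral>\<^sup>+x. f x \<partial>restrict_space (muA N A) (Rset N A i)) =
           ennreal (real N powr - dimA N A) *
           (\<integral>\<^sup>+x. f (prefix i x) \<partial>restrict_space (muA N A) (Dset N A i))"
proof -
  let ?R = "restrict_space (muA N A) (Rset N A i)" and ?D = "restrict_space (muA N A) (Dset N A i)"
  have "integral\<^sup>N ?R f = (\<integral>\<^sup>+x. ennreal (real N powr - dimA N A) * f x \<partial>distr ?D ?R (prefix i))"
    by (subst restrict_Rset_eq[OF N i], rule nn_integral_density) (use f in auto)
  also have "\<dots> = (\<integral>\<^sup>+x. ennreal (real N powr - dimA N A) * f (prefix i x) \<partial>?D)"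
    by (rule nn_integral_distr) (use f measurable_prefix[OF i] in auto)
  also have "\<dots> = ennreal (real N powr - dimA N A) * (\<integral>\<^sup>+x. f (prefix i x) \<partial>?D)"
    by (rule nn_integral_cmult) (rule measurable_compose[OF measurable_prefix[OF i] f])
  finally show ?thesis .
qed

lemma integral_restrict_Rset:
  fixes f :: "_ \<Rightarrow> complex"
  assumes N: "2 \<le> N" and i: "i < N"
    and f: "f \<in> borel_measurable (restrict_space (muA N A) (Rset N A i))"
  shows "(\<integral>x. f x \<partial>restrict_space (muA N A) (Rset N A i)) =
           (real N powr - dimA N A) *\<^sub>R (\<integral>x. f (prefix i x) \<partial>restrict_space (muA N A) (Dset N A i))"
proof -
  let ?R = "restrict_space (muA N A) (Rset N A i)" and ?D = "restrict_space (muA N A) (Dset N A i)"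
  have "integral\<^sup>L ?R f = (\<integral>x. (real N powr - dimA N A) *\<^sub>R f x \<partial>distr ?D ?R (prefix i))"
    by (subst restrict_Rset_eq[OF N i], rule integral_density) (use f in auto)
  also have "\<dots> = (\<integral>x. (real N powr - dimA N A) *\<^sub>R f (prefix i x) \<partial>?D)"
    by (rule integral_distr) (use f measurable_prefix[OF i] in auto)
  finally show ?thesis by simp
qed

lemma mu_prefix_eq:
  assumes N: "2 \<le> N" and i: "i < N"
  shows "mu_prefix N A i =
    density (restrict_space (muA N A) (Dset N A i)) (\<lambda>_. ennreal (real N powr - dimA N A))"
proof -
  let ?D = "restrict_space (muA N A) (Dset N A i)"
  let ?M = "density ?D (\<lambda>_. ennreal (real N powr - dimA N A))"
  have sp: "space ?D = Dset N A i" using Dset_subset by (auto simp: space_restrict_space)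
  have "mu_prefix N A i = measure_of (space ?M) (sets ?M) (emeasure ?M)"
    unfolding mu_prefix_def space_density sets_density sp
  proof (rule measure_of_eq)
    show "sets ?D \<subseteq> Pow (Dset N A i)" using sets.space_closed[of ?D] by (simp add: sp)
    fix B assume "B \<in> sigma_sets (Dset N A i) (sets ?D)"
    hence BD: "B \<in> sets ?D" using sets.sigma_sets_eq[of ?D] by (simp add: sp)
    hence B: "B \<in> sets (muA N A)" "B \<subseteq> Dset N A i" by (auto simp: sets_restrict_Dset)
    show "emeasure (muA N A) (prefix i ` B) = emeasure ?M B"
      using emeasure_prefix_image[OF N i B] emeasure_restrict_space[of "Dset N A i" "muA N A" B] B(2) sets_Dset BD
      by (simp add: emeasure_density_const)
  qed
  thus ?thesis by (simp only: measure_of_of_measure)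
qed

section \<open>Sigma-finiteness\<close>

text \<open>
  The words of length \<open>n\<close> read along the closed admissible walks of length \<open>n\<close> based at the letter
  \<open>i\<close>; the final return to \<open>i\<close> is not part of the word. If \<open>A\<close> has entries in \<open>{0, 1}\<close>, their number
  is a diagonal entry of the \<open>n\<close>-th power of \<open>A\<close>.
\<close>

definition loops :: "nat \<Rightarrow> (nat \<Rightarrow> nat \<Rightarrow> nat) \<Rightarrow> nat \<Rightarrow> nat \<Rightarrow> nat list set" where
  "loops N A i n = (\<lambda>v. map v [0..<n]) `
     {v. v 0 = i \<and> v n = i \<and> (\<forall>k\<le>n. v k < N) \<and> (\<forall>k<n. A (v k) (v (Suc k)) = 1)}"

lemma finite_loops: "finite (loops N A i n)"
proof (rule finite_subset)
  show "loops N A i n \<subseteq> {w. set w \<subseteq> {..<N} \<and> length w = n}"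
    by (auto simp: loops_def)
qed (simp add: finite_lists_length_eq)

lemma length_loops: "w \<in> loops N A i n \<Longrightarrow> length w = n"
  by (auto simp: loops_def)

lemma concat_loops_in_Lam:
  assumes n: "0 < n" and c: "\<And>q. c q \<in> loops N A i n"
  shows "(\<lambda>k. c (k div n) ! (k mod n)) \<in> Lam N A"
proof -
  have "\<exists>v. c q = map v [0..<n] \<and> v 0 = i \<and> v n = i \<and> (\<forall>k\<le>n. v k < N) \<and>
          (\<forall>k<n. A (v k) (v (Suc k)) = 1)" for q
    using c[of q] by (auto simp: loops_def)
  then obtain v where v: "\<And>q. c q = map (v q) [0..<n]" "\<And>q. v q 0 = i" "\<And>q. v q n = i"
      "\<And>q k. k \<le> n \<Longrightarrow> v q k < N" "\<And>q k. k < n \<Longrightarrow> A (v q k) (v q (Suc k)) = 1"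
    by metis
  have nth: "c q ! r = v q r" if "r < n" for q r using that by (simp add: v(1))
  show ?thesis
    unfolding Lam_def
  proof (intro CollectI conjI allI)
    fix k
    define q r where "q = k div n" and "r = k mod n"
    have r: "r < n" using n by (simp add: r_def)
    show "c (k div n) ! (k mod n) < N"
      using v(4)[of r q] r by (simp add: nth flip: q_def r_def)
    have step: "c (Suc k div n) ! (Suc k mod n) = v q (Suc r)"
    proof (cases "Suc r = n")
      case True
      hence "Suc k div n = Suc q" "Suc k mod n = 0"
        by (simp_all add: div_Suc mod_Suc q_def r_def)
      thus ?thesis using True n v(2,3) by (simp add: nth)
    next
      case False
      hence "Suc k div n = q" "Suc k mod n = Suc r"
        by (simp_all add: div_Suc mod_Suc q_def r_def)
      thus ?thesis using False r by (simp add: nth)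
    qed
    show "A (c (k div n) ! (k mod n)) (c (Suc k div n) ! (Suc k mod n)) = 1"
      using v(5)[OF r, of q] r by (simp add: step nth flip: q_def r_def)
  qed
qed

text \<open>
  For \<open>L = card (loops N A i n)\<close>, concatenating loops freely gives a Cantor set of dimension at least
  \<open>log N L / n\<close>. The mass distribution is Lebesgue measure on the unit interval,
  transported by reading the base \<open>L\<close> digits of a number as indices of loops.
\<close>

lemma hausdorff_outer_loops_pos:
  assumes N: "2 \<le> N" and n: "0 < n" and L: "L = card (loops N A i n)" "2 \<le> L"
    and t: "real L = real N powr (real n * t)" and s: "0 \<le> s" "s \<le> t"
  shows "hausdorff_outer s (val N ` Lam N A) \<noteq> 0"
proof -
  obtain b where b: "bij_betw b {..<L} (loops N A i n)"
    using bij_betw_from_nat_into_finite[OF finite_loops[of N A i n]] by (auto simp: L(1))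
  define code where "code y k = b (digits L y (k div n)) ! (k mod n)" for y k
  define M where "M = restrict_space lborel {0..<1::real}"
  define f where "f y = val N (code y)" for y
  have spM: "space M = {0..<1}" by (simp add: M_def space_restrict_space)
  have dig: "digits L y k < L" if "y \<in> space M" for y k
    using that L(2) by (auto simp: spM intro: digits_less)
  have bl: "b (digits L y k) \<in> loops N A i n" if "y \<in> space M" for y k
    using dig[OF that, of k] bij_betwE[OF b] by auto
  have code_Lam: "code y \<in> Lam N A" if "y \<in> space M" for y
    unfolding code_def[abs_def] using concat_loops_in_Lam[OF n, of "\<lambda>q. b (digits L y q)"] bl[OF that] by blast
  hence code_digit: "code y \<in> digit_seqs N" if "y \<in> space M" for y
    using that Lam_digit_seqs by blast
  have "(\<lambda>y. digits L y k) \<in> measurable borel (count_space UNIV)" for k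
    by (rule measurable_compose[OF borel_measurable_digits measurable_letter])
  hence "code \<in> borel_measurable borel"
    unfolding code_def by (intro borel_measurable_seqI) (rule measurable_compose, assumption, simp)
  hence "f \<in> borel_measurable borel"
    unfolding f_def by (rule measurable_compose[OF _ borel_measurable_val])
  hence f: "f \<in> borel_measurable M"
    unfolding M_def by (intro measurable_restrict_space1) simp
  have letters: "digits L y m = digits L z m"
    if y: "y \<in> space M" "z \<in> space M" and m: "m < k"
      and eq: "word_num N (code y) (n * k) = word_num N (code z) (n * k)" for y z m k
  proof -
    have "b (digits L y m) = b (digits L z m)"
    proof (rule nth_equalityI)
      show "length (b (digits L y m)) = length (b (digits L z m))"
        using length_loops[OF bl[OF y(1)]] length_loops[OF bl[OF y(2)]] by simp
      fix r assume "r < length (b (digits L y m))"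
      hence r: "r < n" using length_loops[OF bl[OF y(1)]] by simp
      have "m * n + r < Suc m * n" using r by simp
      also have "\<dots> \<le> k * n" using m by (intro mult_le_mono1) simp
      finally have "code y (m * n + r) = code z (m * n + r)"
        by (intro word_num_inj[OF code_digit[OF y(1)] code_digit[OF y(2)] eq]) (simp add: mult.commute)
      thus "b (digits L y m) ! r = b (digits L z m) ! r" using r by (simp add: code_def)
    qed
    thus ?thesis using b dig[OF y(1), of m] dig[OF y(2), of m] by (auto simp: bij_betw_def inj_on_def)
  qed
  \<comment> \<open>The values in a set of diameter at most \<open>N ^ - (n * k)\<close> have at most five different integers formed by
    their first \<open>n * k\<close> digits, and each integer leaves an interval of length \<open>L ^ - k\<close> for \<open>y\<close>.\<close>
  have cyl: "emeasure M (f -` U \<inter> space M) \<le> ennreal (5 * (1 / real L) ^ k)"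
    if U: "closed U" "bounded U" and diam: "diameter U \<le> (1 / real N) ^ (n * k)" for U k
  proof (cases "f -` U \<inter> space M = {}")
    case False
    then obtain z where z: "f z \<in> U" "z \<in> space M" by auto
    define num where "num y = word_num N (code y) (n * k)" for y
    define S where "S = {num z - 2..num z + 2}"
    define I where "I a = {y \<in> space M. num y = a}" for a
    have num: "real (num y) \<le> real N ^ (n * k) * f y" "real N ^ (n * k) * f y \<le> real (num y) + 1"
      if "y \<in> space M" for y
      using val_word_num[OF N code_digit[OF that], of "n * k"]
        val_nonneg[OF N shift_digit_seqs[OF code_digit[OF that]], of "n * k"]
        val_le_1[OF N shift_digit_seqs[OF code_digit[OF that]], of "n * k"]
      by (simp_all add: num_def f_def)
    have "num y \<in> S" if y: "f y \<in> U" "y \<in> space M" for y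
    proof -
      have "\<bar>f y - f z\<bar> \<le> (1 / real N) ^ (n * k)"
        using diameter_bounded_bound[OF U(2) y(1) z(1)] diam by (simp add: dist_real_def)
      hence "real N ^ (n * k) * \<bar>f y - f z\<bar> \<le> real N ^ (n * k) * (1 / real N) ^ (n * k)"
        by (intro mult_left_mono) auto
      also have "\<dots> = 1" using N by (simp add: power_divide)
      finally have "\<bar>real N ^ (n * k) * f y - real N ^ (n * k) * f z\<bar> \<le> 1"
        by (simp add: abs_mult flip: right_diff_distrib)
      hence "real (num y) \<le> real (num z) + 2" "real (num z) \<le> real (num y) + 2"
        using num[OF y(2)] num[OF z(2)] by linarith+
      thus ?thesis by (auto simp: S_def)
    qed
    hence sub: "f -` U \<inter> space M \<subseteq> (\<Union>a\<in>S. I a)" by (auto simp: I_def)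
    have "\<exists>p. I a \<subseteq> {p..p + (1 / real L) ^ k}" for a
    proof (cases "I a = {}")
      case False
      then obtain x where x: "x \<in> space M" "num x = a" by (auto simp: I_def)
      define p where "p = real (word_num L (digits L x) k)"
      have "y \<in> {p * (1 / real L) ^ k..p * (1 / real L) ^ k + (1 / real L) ^ k}" if "y \<in> I a" for y
      proof -
        have y: "y \<in> space M" "num y = num x" using that x by (auto simp: I_def)
        have "word_num L (digits L y) k = word_num L (digits L x) k"
          by (rule word_num_cong) (use letters[OF y(1) x(1)] y(2) in \<open>auto simp: num_def\<close>)
        hence "p \<le> real L ^ k * y" "real L ^ k * y \<le> p + 1"
          using word_num_digits[of y L k] digit_map_range[of y k L] y(1) by (auto simp: spM p_def)
        thus ?thesis using L(2) by (simp add: power_divide field_simps)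
      qed
      thus ?thesis by blast
    qed auto
    then obtain p where p: "\<And>a. I a \<subseteq> {p a..p a + (1 / real L) ^ k}" by metis
    have "f -` U \<inter> space M \<in> sets M" using U(1) by (intro measurable_sets[OF f]) auto
    hence "emeasure M (f -` U \<inter> space M) = emeasure lborel (f -` U \<inter> space M)"
      unfolding M_def by (subst emeasure_restrict_space) (auto simp: space_restrict_space)
    also have "\<dots> \<le> emeasure lborel (\<Union>a\<in>S. {p a..p a + (1 / real L) ^ k})"
      by (rule emeasure_mono) (use sub p in \<open>blast, auto simp: S_def intro!: sets.finite_UN\<close>)
    also have "\<dots> \<le> (\<Sum>a\<in>S. emeasure lborel {p a..p a + (1 / real L) ^ k})"
      by (rule emeasure_subadditive_finite) (auto simp: S_def)
    also have "\<dots> = of_nat (card S) * ennreal ((1 / real L) ^ k)"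
      by simp
    also have "\<dots> \<le> ennreal 5 * ennreal ((1 / real L) ^ k)"
    proof (rule mult_right_mono)
      have "card S \<le> 5" by (simp add: S_def)
      hence "of_nat (card S) \<le> (of_nat 5 :: ennreal)" by (rule of_nat_mono)
      thus "of_nat (card S) \<le> ennreal 5" by simp
    qed simp
    also have "\<dots> = ennreal (5 * (1 / real L) ^ k)" by (simp add: ennreal_mult)
    finally show ?thesis .
  qed simp
  have mass: "emeasure M (f -` U \<inter> space M) \<le> ennreal (5 * real L) * diam_pow s U"
    if U: "closed U" "bounded U" "U \<noteq> {}" "diameter U \<le> 1" for U
  proof (cases "s = 0")
    case True
    have "emeasure M (f -` U \<inter> space M) \<le> ennreal 5"
      using cyl[of U 0] U by simp
    also have "\<dots> \<le> ennreal (5 * real L)" using L(2) by (intro ennreal_leI) simp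
    finally show ?thesis using True U(3) by (simp add: diam_pow_def)
  next
    case s_pos: False
    define D where "D = diameter U"
    have D: "0 \<le> D" "D \<le> 1" using U diameter_ge_0 by (auto simp: D_def)
    show ?thesis
    proof (cases "D = 0")
      case True
      have "emeasure M (f -` U \<inter> space M) \<le> 0"
      proof (rule ennreal_le_epsilon)
        fix e :: real assume e: "0 < e"
        obtain k where "(1 / real L) ^ k < e / 5"
          using real_arch_pow_inv[of "e / 5" "1 / real L"] e L(2) by auto
        hence "ennreal (5 * (1 / real L) ^ k) \<le> ennreal e" by (intro ennreal_leI) simp
        with cyl[OF U(1,2), of k] True show "emeasure M (f -` U \<inter> space M) \<le> 0 + ennreal e"
          by (simp add: D_def)
      qed
      thus ?thesis by simp
    next
      case False
      \<comment> \<open>Choose \<open>k\<close> with \<open>N ^ - (n * (k + 1)) < D \<le> N ^ - (n * k)\<close>; the gap between the bounds costs a factor \<open>L\<close>.\<close>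
      define r where "r = (1 / real N) ^ n"
      have r: "0 < r" "r < 1" using N n by (auto simp: r_def power_less_one_iff)
      obtain j where j: "r ^ j < D" using real_arch_pow_inv[of D r] False D r by auto
      define m where "m = (LEAST j. r ^ j < D)"
      have m: "r ^ m < D" unfolding m_def by (rule LeastI) (rule j)
      have "m \<noteq> 0" using m D by (intro notI) simp
      then obtain k where k: "m = Suc k" by (cases m) auto
      have "\<not> r ^ k < D" by (rule not_less_Least) (use k in \<open>simp add: m_def\<close>)
      hence Dk: "D \<le> r ^ k" by simp
      have rt: "r powr t = 1 / real L"
      proof -
        have "r = real N powr (- real n)"
          using N by (simp add: r_def powr_minus_divide powr_realpow power_divide)
        hence "r powr t = real N powr - (real n * t)" by (simp only: powr_powr minus_mult_left)
        thus ?thesis by (simp only: t powr_minus_divide)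
      qed
      have "emeasure M (f -` U \<inter> space M) \<le> ennreal (5 * (1 / real L) ^ k)"
        by (rule cyl[OF U(1,2)]) (use Dk in \<open>simp add: D_def r_def power_mult\<close>)
      also have "\<dots> \<le> ennreal (5 * real L * D powr s)"
      proof (rule ennreal_leI)
        have "(1 / real L) ^ Suc k = (r powr t) powr real (Suc k)"
          unfolding rt using L(2) by (intro powr_realpow[symmetric]) simp
        also have "\<dots> = (r powr real (Suc k)) powr t" by (simp only: powr_powr mult.commute)
        also have "r powr real (Suc k) = r ^ Suc k" by (rule powr_realpow[OF r(1)])
        finally have "(1 / real L) ^ Suc k = (r ^ Suc k) powr t" .
        also have "\<dots> \<le> D powr t" using m r s by (intro powr_mono2) (auto simp: k)
        also have "\<dots> \<le> D powr s" using s D by (intro powr_mono') auto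
        finally have "5 * real L * (1 / real L) ^ Suc k \<le> 5 * real L * D powr s"
          by (intro mult_left_mono) auto
        moreover have "real L * (1 / real L) ^ Suc k = (1 / real L) ^ k" using L(2) by simp
        ultimately show "5 * (1 / real L) ^ k \<le> 5 * real L * D powr s" by (simp only: mult.assoc)
      qed
      also have "\<dots> = ennreal (5 * real L) * diam_pow s U"
        using U(3) s_pos by (simp add: diam_pow_def D_def ennreal_mult)
      finally show ?thesis .
    qed
  qed
  have "emeasure M (space M) \<le> ennreal (5 * real L) * hausdorff_outer s (val N ` Lam N A)"
    by (rule mass_distribution_principle[where r = 1 and f = f]) (use f mass code_Lam L(2) in \<open>auto simp: f_def\<close>)
  moreover have "emeasure M (space M) = 1"
    by (simp add: spM) (simp add: M_def emeasure_restrict_space)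
  ultimately show ?thesis by auto
qed

text \<open>The dimension is finite, so its conversion to a real number in \<open>dimA\<close> loses nothing.\<close>

lemma hausdorff_dim_eq_dimA:
  assumes "2 \<le> N"
  shows "hausdorff_dim (val N ` Lam N A) = ennreal (dimA N A)"
proof -
  have "val N ` Lam N A \<subseteq> {0..1}"
    using val_nonneg[OF assms] val_le_1[OF assms] Lam_digit_seqs[of N A] by auto
  hence "hausdorff_outer 2 (val N ` Lam N A) = 0"
    using hausdorff_outer_mono[of "val N ` Lam N A" "{0..1}" 2] hausdorff_outer_2_unit_interval by simp
  hence "hausdorff_dim (val N ` Lam N A) \<le> ennreal 2"
    unfolding hausdorff_dim_def by (intro INF_lower) auto
  also have "\<dots> < top" by simp
  finally show ?thesis by (simp add: dimA_def)
qed

text \<open>A larger number of loops would contradict the value of the dimension.\<close>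

lemma card_loops_le:
  assumes N: "2 \<le> N" and n: "0 < n"
  shows "real (card (loops N A i n)) \<le> real N powr (real n * dimA N A)"
proof (rule ccontr)
  define L where "L = card (loops N A i n)"
  assume "\<not> ?thesis"
  hence gt: "real N powr (real n * dimA N A) < real L" by (simp add: L_def)
  have "1 \<le> real N powr (real n * dimA N A)"
    using N by (intro ge_one_powr_ge_zero) (auto simp: dimA_nonneg)
  hence L: "2 \<le> L" using gt by linarith
  define t where "t = log (real N) (real L) / real n"
  have t: "real L = real N powr (real n * t)" using N n L by (simp add: t_def)
  have "dimA N A < t"
  proof -
    have "real n * dimA N A < real n * t"
      using gt N unfolding t by (subst (asm) powr_less_cancel_iff) auto
    thus ?thesis using n by simp
  qed
  hence "hausdorff_dim (val N ` Lam N A) < ennreal t"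
    unfolding hausdorff_dim_eq_dimA[OF N] by (intro ennreal_lessI) (use dimA_nonneg[of N A] in linarith)
  then obtain s where s: "0 \<le> s" "hausdorff_outer s (val N ` Lam N A) = 0" "ennreal s < ennreal t"
    unfolding hausdorff_dim_def INF_less_iff by auto
  thus False using hausdorff_outer_loops_pos[OF N n L_def L t, of s] by (simp add: ennreal_less_iff)
qed

text \<open>Sequences starting at a letter \<open>i\<close> to which they return infinitely often.\<close>

definition recurrent :: "nat \<Rightarrow> (nat \<Rightarrow> nat \<Rightarrow> nat) \<Rightarrow> nat \<Rightarrow> (nat \<Rightarrow> nat) set" where
  "recurrent N A i = {x \<in> Lam N A. x 0 = i \<and> (\<forall>n. \<exists>k. x (n + k) = i)}"

lemma sets_recurrent: "recurrent N A i \<in> sets (muA N A)"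
proof -
  have "recurrent N A i = Lam N A \<inter> {x. x 0 = i} \<inter> (\<Inter>n. \<Union>k. {x. x (n + k) = i})"
    by (auto simp: recurrent_def)
  also have "\<dots> \<in> sets borel"
    by (intro sets.Int sets_Lam sets.countable_UN'' sets.countable_INT'' sets_letter) auto
  finally show ?thesis by (auto simp: sets_muA_iff recurrent_def)
qed

lemma recurrent_return_time:
  assumes diag: "\<And>j. j < N \<Longrightarrow> A j j = 1"
  obtains M where "\<And>x m. x \<in> recurrent N A i \<Longrightarrow> \<exists>u. u 0 = x m \<and> u M = i \<and> (\<forall>k\<le>M. u k < N) \<and>
    (\<forall>k<M. A (u k) (u (Suc k)) = 1)"
proof -
  define ret where "ret M j = (\<exists>u. u 0 = j \<and> u M = i \<and> (\<forall>k\<le>M. u k < N) \<and>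
    (\<forall>k<M. A (u k) (u (Suc k)) = 1))" for M j
  \<comment> \<open>The diagonal entries are 1, so a walk to \<open>i\<close> can be prolonged by staying at \<open>i\<close>.\<close>
  have Suc: "ret (Suc M) j" if "ret M j" for M j
  proof -
    from that obtain u where u: "u 0 = j" "u M = i" "\<forall>k\<le>M. u k < N" "\<forall>k<M. A (u k) (u (Suc k)) = 1"
      unfolding ret_def by blast
    have "i < N" using u(2,3) by auto
    hence "A i i = 1" by (rule diag)
    thus ?thesis unfolding ret_def
      by (intro exI[of _ "\<lambda>k. if k \<le> M then u k else i"]) (use u \<open>i < N\<close> in \<open>auto simp: less_Suc_eq\<close>)
  qed
  have mono: "ret M' j" if "ret M j" "M \<le> M'" for M M' j
    using that(2,1) by (induction rule: dec_induct) (auto intro: Suc)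
  define J where "J = {j. j < N \<and> (\<exists>M. ret M j)}"
  have "finite J" by (rule finite_subset[of _ "{..<N}"]) (auto simp: J_def)
  moreover have "\<forall>j\<in>J. \<exists>M. ret M j" by (simp add: J_def)
  then obtain T where T: "\<And>j. j \<in> J \<Longrightarrow> ret (T j) j" by metis
  ultimately have all: "ret (Max (T ` J)) j" if "j \<in> J" for j
    using that by (intro mono[OF T[OF that]]) auto
  have "ret (Max (T ` J)) (x m)" if x: "x \<in> recurrent N A i" for x m
  proof (rule all)
    obtain k where "x (m + k) = i" using x by (auto simp: recurrent_def)
    hence "ret k (x m)" unfolding ret_def
      by (intro exI[of _ "\<lambda>l. x (m + l)"]) (use x in \<open>auto simp: recurrent_def Lam_def\<close>)
    thus "x m \<in> J" using x by (auto simp: J_def recurrent_def Lam_def)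
  qed
  thus ?thesis unfolding ret_def by (rule that)
qed

text \<open>
  The beginning of a sequence in \<open>recurrent N A i\<close> extends to a loop at \<open>i\<close> by a return path of
  bounded length, so the bound on the number of loops bounds the number of cylinders needed to cover
  these sequences.
\<close>

lemma hausdorff_outer_recurrent_finite:
  assumes N: "2 \<le> N" and diag: "\<And>j. j < N \<Longrightarrow> A j j = 1"
  shows "hausdorff_outer (dimA N A) (val N ` recurrent N A i) < top"
proof -
  define \<delta> where "\<delta> = dimA N A"
  obtain M where M: "\<And>x m. x \<in> recurrent N A i \<Longrightarrow> \<exists>u. u 0 = x m \<and> u M = i \<and> (\<forall>k\<le>M. u k < N) \<and>
      (\<forall>k<M. A (u k) (u (Suc k)) = 1)"
    using recurrent_return_time[of N A i] diag by blast
  have "hausdorff_outer \<delta> (val N ` recurrent N A i) \<le> ennreal (real N powr (real M * \<delta>))"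
  proof (rule hausdorff_outer_least)
    fix d :: real assume d: "0 < d"
    obtain m' where m': "(1 / real N) ^ m' < d" using real_arch_pow_inv[of d "1 / real N"] d N by auto
    define m where "m = Suc m'"
    have "(1 / real N) ^ m \<le> (1 / real N) ^ m'" using N by (intro power_decreasing) (auto simp: m_def)
    hence m: "(1 / real N) ^ m \<le> d" "0 < m" using m' by (auto simp: m_def)
    define V where "V l = val N ` {x \<in> Lam N A. \<forall>k<m. x k = l ! k}" for l
    have "hausdorff_premeasure \<delta> d (val N ` recurrent N A i)
            \<le> of_nat (card (loops N A i (m + M))) * ennreal (((1 / real N) ^ m) powr \<delta>)"
    proof (rule hausdorff_premeasure_finite_cover)
      show "val N ` recurrent N A i \<subseteq> (\<Union>l\<in>loops N A i (m + M). V l)"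
      proof
        fix y assume "y \<in> val N ` recurrent N A i"
        then obtain x where x: "x \<in> recurrent N A i" "y = val N x" by auto
        from M[OF x(1), of m] obtain u where u: "u 0 = x m" "u M = i" "\<forall>k\<le>M. u k < N"
          "\<forall>k<M. A (u k) (u (Suc k)) = 1" by blast
        \<comment> \<open>Follow \<open>x\<close> up to time \<open>m\<close> and then the return path.\<close>
        define v where "v k = (if k \<le> m then x k else u (k - m))" for k
        have xL: "x k < N" "A (x k) (x (Suc k)) = 1" "x 0 = i" for k
          using x(1) by (auto simp: recurrent_def Lam_def)
        have "v (m + M) = i" using u(1,2) by (cases "M = 0") (auto simp: v_def)
        moreover have "A (v k) (v (Suc k)) = 1" if "k < m + M" for k
        proof -
          consider "k < m" | "k = m" | "m < k" by linarith
          thus ?thesis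
          proof cases
            case 2
            thus ?thesis using u(4)[rule_format, of 0] u(1) that by (simp add: v_def)
          next
            case 3
            thus ?thesis using u(4)[rule_format, of "k - m"] that by (simp add: v_def Suc_diff_le)
          qed (use xL in \<open>simp add: v_def\<close>)
        qed
        moreover have "v k < N" if "k \<le> m + M" for k using xL u(3) that by (auto simp: v_def)
        ultimately have "map v [0..<m + M] \<in> loops N A i (m + M)"
          unfolding loops_def by (intro imageI) (simp add: v_def xL)
        moreover have "x k = map v [0..<m + M] ! k" if "k < m" for k using that by (simp add: v_def)
        hence "y \<in> V (map v [0..<m + M])" using x by (auto simp: V_def recurrent_def)
        ultimately show "y \<in> (\<Union>l\<in>loops N A i (m + M). V l)" by blast
      qed
      fix l
      have dist: "dist y z \<le> (1 / real N) ^ m" if "y \<in> V l" "z \<in> V l" for y z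
      proof -
        from that obtain x x' where x: "x \<in> Lam N A" "\<forall>k<m. x k = l ! k" "y = val N x"
          and x': "x' \<in> Lam N A" "\<forall>k<m. x' k = l ! k" "z = val N x'"
          unfolding V_def by blast
        have "\<bar>val N x - val N x'\<bar> \<le> (1 / real N) ^ m"
          using x x' Lam_digit_seqs[of N A] by (intro val_dist_le[OF N]) auto
        thus ?thesis by (simp add: x(3) x'(3) dist_real_def)
      qed
      show "bounded (V l)" unfolding bounded_two_points using dist by blast
      show diam: "diameter (V l) \<le> d"
        using diameter_le[of "V l" "(1 / real N) ^ m"] dist m(1) N by (force simp: dist_real_def)
      have "diameter (V l) \<le> (1 / real N) ^ m"
        using diameter_le[of "V l" "(1 / real N) ^ m"] dist N by (force simp: dist_real_def)
      hence "diameter (V l) powr \<delta> \<le> ((1 / real N) ^ m) powr \<delta>"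
        using diameter_ge_0[OF \<open>bounded (V l)\<close>] by (intro powr_mono2) (auto simp: \<delta>_def dimA_nonneg)
      thus "diam_pow \<delta> (V l) \<le> ennreal (((1 / real N) ^ m) powr \<delta>)"
        using N by (auto simp: diam_pow_def intro: ennreal_leI)
    qed (use d finite_loops in auto)
    also have "\<dots> = ennreal (real (card (loops N A i (m + M))) * ((1 / real N) ^ m) powr \<delta>)"
      by (simp add: ennreal_mult ennreal_of_nat_eq_real_of_nat)
    also have "\<dots> \<le> ennreal (real N powr (real M * \<delta>))"
    proof (rule ennreal_leI)
      have "(1 / real N) ^ m = real N powr (- real m)"
        using N by (simp add: powr_minus_divide powr_realpow power_divide)
      hence "((1 / real N) ^ m) powr \<delta> = real N powr (- real m * \<delta>)"
        by (simp only: powr_powr)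
      moreover have "real (card (loops N A i (m + M))) * real N powr (- real m * \<delta>)
          \<le> real N powr (real (m + M) * \<delta>) * real N powr (- real m * \<delta>)"
        unfolding \<delta>_def using m(2) by (intro mult_right_mono card_loops_le[OF N]) auto
      moreover have "\<dots> = real N powr (real M * \<delta>)"
        by (simp add: powr_add[symmetric] algebra_simps)
      ultimately show "real (card (loops N A i (m + M))) * ((1 / real N) ^ m) powr \<delta>
                      \<le> real N powr (real M * \<delta>)" by simp
    qed
    finally show "hausdorff_premeasure \<delta> d (val N ` recurrent N A i)
                    \<le> ennreal (real N powr (real M * \<delta>))" .
  qed
  thus ?thesis unfolding \<delta>_def by (rule le_less_trans) simp
qed

lemma sets_shift_vimage:
  assumes "F \<in> sets (muA N A)"
  shows "{x \<in> Lam N A. shift x \<in> F} \<in> sets (muA N A)"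
proof -
  have "{x \<in> Lam N A. shift x \<in> F} = Lam N A \<inter> shift -` F" by auto
  thus ?thesis
    using measurable_sets[OF borel_measurable_shift sets_muA_borel[OF assms]] sets_Lam[of N A]
    by (simp add: sets_muA_iff)
qed

lemma emeasure_shift_vimage_finite:
  assumes N: "2 \<le> N" and F: "F \<in> sets (muA N A)" "emeasure (muA N A) F < top"
  shows "emeasure (muA N A) {x \<in> Lam N A. shift x \<in> F} < top"
proof -
  have FD: "F \<inter> Dset N A j \<in> sets (muA N A)" for j using F(1) sets_Dset by auto
  have sub: "{x \<in> Lam N A. shift x \<in> F} \<subseteq> (\<Union>j\<in>{..<N}. prefix j ` (F \<inter> Dset N A j))"
  proof
    fix x assume x: "x \<in> {x \<in> Lam N A. shift x \<in> F}"
    hence "x \<in> Rset N A (x 0)" "x 0 < N" by (auto simp: Rset_def Lam_def)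
    thus "x \<in> (\<Union>j\<in>{..<N}. prefix j ` (F \<inter> Dset N A j))"
      using x by (auto intro!: bexI[of _ "x 0"] simp: prefix_image_eq shift_in_Dset)
  qed
  have "emeasure (muA N A) {x \<in> Lam N A. shift x \<in> F}
          \<le> emeasure (muA N A) (\<Union>j\<in>{..<N}. prefix j ` (F \<inter> Dset N A j))"
    by (rule emeasure_mono[OF sub]) (use FD in \<open>auto intro!: sets_prefix_image\<close>)
  also have "\<dots> \<le> (\<Sum>j<N. emeasure (muA N A) (prefix j ` (F \<inter> Dset N A j)))"
    by (rule emeasure_subadditive_finite) (use FD in \<open>auto intro!: sets_prefix_image\<close>)
  also have "\<dots> \<le> (\<Sum>j<N. ennreal (real N powr - dimA N A) * emeasure (muA N A) F)"
  proof (rule sum_mono)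
    fix j assume "j \<in> {..<N}"
    hence "emeasure (muA N A) (prefix j ` (F \<inter> Dset N A j))
             = ennreal (real N powr - dimA N A) * emeasure (muA N A) (F \<inter> Dset N A j)"
      using FD by (intro emeasure_prefix_image[OF N]) auto
    thus "emeasure (muA N A) (prefix j ` (F \<inter> Dset N A j))
            \<le> ennreal (real N powr - dimA N A) * emeasure (muA N A) F"
      using F(1) by (auto intro!: mult_left_mono emeasure_mono)
  qed
  also have "\<dots> < top" using F(2) by (simp add: ennreal_mult_less_top of_nat_less_top)
  finally show ?thesis .
qed

theorem sigma_finite_muA:
  assumes N: "2 \<le> N" and diag: "\<And>j. j < N \<Longrightarrow> A j j = 1"
  shows "sigma_finite_measure (muA N A)"
proof
  define F where "F n i = {x \<in> Lam N A. (shift ^^ n) x \<in> recurrent N A i}" for n i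
  have F: "F n i \<in> sets (muA N A) \<and> emeasure (muA N A) (F n i) < top" for n i
  proof (induction n)
    case 0
    have "F 0 i = recurrent N A i" by (auto simp: F_def recurrent_def)
    moreover have "hausdorff_outer (dimA N A) (val N ` recurrent N A i) < top"
      by (rule hausdorff_outer_recurrent_finite[OF N]) (rule diag)
    hence "emeasure (muA N A) (recurrent N A i) < top"
      using emeasure_muA_le[OF N sets_recurrent[of N A i]]
      by (auto simp: ennreal_mult_less_top elim: le_less_trans)
    ultimately show ?case by (simp add: sets_recurrent)
  next
    case (Suc n)
    have "F (Suc n) i = {x \<in> Lam N A. shift x \<in> F n i}"
      by (auto simp: F_def shift_in_Lam funpow_swap1)
    thus ?case using sets_shift_vimage emeasure_shift_vimage_finite[OF N] Suc.IH by simp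
  qed
  \<comment> \<open>Some letter occurs infinitely often, so the tail starting at an occurrence of it is recurrent.\<close>
  define FF where "FF = (\<Union>n. \<Union>i<N. {F n i})"
  have "Lam N A \<subseteq> \<Union>FF"
  proof
    fix x assume x: "x \<in> Lam N A"
    have "finite (range x)" by (rule finite_subset[of _ "{..<N}"]) (use x in \<open>auto simp: Lam_def\<close>)
    then obtain m where m: "infinite {k. x k = x m}"
      using pigeonhole_infinite[of UNIV x] by auto
    have "\<exists>k. x (m + (n + k)) = x m" for n
    proof -
      obtain k where "m + n < k" "x k = x m" using m unfolding infinite_nat_iff_unbounded by blast
      thus ?thesis by (intro exI[of _ "k - (m + n)"]) simp
    qed
    moreover have "(shift ^^ m) x \<in> Lam N A" using x by (simp add: Lam_def funpow_shift_apply)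
    ultimately have "x \<in> F m (x m)" using x by (simp add: F_def recurrent_def funpow_shift_apply)
    moreover have "x m < N" using x by (simp add: Lam_def)
    ultimately show "x \<in> \<Union>FF" by (auto simp: FF_def)
  qed
  moreover have "\<Union>FF \<subseteq> Lam N A" by (auto simp: FF_def F_def)
  ultimately show "\<exists>FF. countable FF \<and> FF \<subseteq> sets (muA N A) \<and> \<Union>FF = space (muA N A) \<and>
      (\<forall>a\<in>FF. emeasure (muA N A) a \<noteq> \<infinity>)"
    using F by (intro exI[of _ FF]) (auto simp: FF_def less_top[symmetric])
qed

section \<open>The Radon-Nikodym derivative of the prefix maps\<close>

lemma measurable_Phi:
  "Phi N A i \<in> borel_measurable (restrict_space (muA N A) (Dset N A i))"
  unfolding Phi_def by measurable

lemma AE_Phi: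
  assumes N: "2 \<le> N" and diag: "\<And>j. j < N \<Longrightarrow> A j j = 1" and i: "i < N"
  shows "AE x in restrict_space (muA N A) (Dset N A i). Phi N A i x = real N powr - dimA N A"
proof -
  interpret sigma_finite_measure "muA N A" by (rule sigma_finite_muA[OF N diag])
  interpret D: sigma_finite_measure "restrict_space (muA N A) (Dset N A i)"
    by (rule sigma_finite_measure_restrict_space) (rule sigma_finite_measure_axioms, rule sets_Dset)
  have "AE x in restrict_space (muA N A) (Dset N A i).
      ennreal (real N powr - dimA N A) = RN_deriv (restrict_space (muA N A) (Dset N A i)) (mu_prefix N A i) x"
    by (rule D.RN_deriv_unique) (simp_all add: mu_prefix_eq[OF N i])
  thus ?thesis
  proof (rule AE_mp[OF _ AE_I2], safe)
    fix x
    assume eq: "ennreal (real N powr - dimA N A) =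
      RN_deriv (restrict_space (muA N A) (Dset N A i)) (mu_prefix N A i) x"
    thus "Phi N A i x = real N powr - dimA N A" by (simp add: Phi_def eq[symmetric])
  qed
qed

section \<open>Square-integrable functions\<close>

lemma borel_measurable_cnj [measurable]: "cnj \<in> borel_measurable borel"
  by (intro borel_measurable_continuous_onI continuous_intros)

lemma L2_measurable: "f \<in> L2 M \<Longrightarrow> f \<in> borel_measurable M"
  by (simp add: L2_def)

lemma L2_integrable: "f \<in> L2 M \<Longrightarrow> integrable M (\<lambda>x. (cmod (f x))\<^sup>2)"
  by (simp add: L2_def)

lemma L2_iff_nn_integral:
  assumes "f \<in> borel_measurable M"
  shows "f \<in> L2 M \<longleftrightarrow> (\<integral>\<^sup>+x. ennreal ((cmod (f x))\<^sup>2) \<partial>M) < \<infinity>"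
  using assms by (simp add: L2_def integrable_iff_bounded)

lemma integrable_L2_mult:
  assumes "f \<in> L2 M" "g \<in> L2 M"
  shows "integrable M (\<lambda>x. cnj (f x) * g x)"
proof (rule Bochner_Integration.integrable_bound)
  show "integrable M (\<lambda>x. (cmod (f x))\<^sup>2 + (cmod (g x))\<^sup>2)"
    using assms by (intro Bochner_Integration.integrable_add L2_integrable)
  have [measurable]: "f \<in> borel_measurable M" "g \<in> borel_measurable M" using assms by (auto intro: L2_measurable)
  show "(\<lambda>x. cnj (f x) * g x) \<in> borel_measurable M" by measurable
  have "a * b \<le> a\<^sup>2 + b\<^sup>2" if "0 \<le> a" "0 \<le> b" for a b :: real
    using sum_squares_bound[of a b] mult_nonneg_nonneg[OF that] by linarith
  thus "AE x in M. norm (cnj (f x) * g x) \<le> norm ((cmod (f x))\<^sup>2 + (cmod (g x))\<^sup>2)"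
    by (simp add: norm_mult)
qed

lemma L2_diff:
  assumes "f \<in> L2 M" "g \<in> L2 M"
  shows "(\<lambda>x. f x - g x) \<in> L2 M"
proof -
  have [measurable]: "f \<in> borel_measurable M" "g \<in> borel_measurable M" using assms by (auto intro: L2_measurable)
  have "integrable M (\<lambda>x. (cmod (f x - g x))\<^sup>2)"
  proof (rule Bochner_Integration.integrable_bound)
    show "integrable M (\<lambda>x. 2 * (cmod (f x))\<^sup>2 + 2 * (cmod (g x))\<^sup>2)"
      using assms by (intro Bochner_Integration.integrable_add integrable_mult_right L2_integrable)
    have "(cmod (a - b))\<^sup>2 \<le> 2 * (cmod a)\<^sup>2 + 2 * (cmod b)\<^sup>2" for a b
    proof -
      have "(cmod (a - b))\<^sup>2 \<le> (cmod a + cmod b)\<^sup>2"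
        by (intro power_mono norm_triangle_ineq4) auto
      also have "\<dots> \<le> 2 * (cmod a)\<^sup>2 + 2 * (cmod b)\<^sup>2"
        using sum_squares_bound[of "cmod a" "cmod b"] by (simp add: power2_sum)
      finally show ?thesis .
    qed
    thus "AE x in M. norm ((cmod (f x - g x))\<^sup>2) \<le> norm (2 * (cmod (f x))\<^sup>2 + 2 * (cmod (g x))\<^sup>2)"
      by simp
  qed measurable
  thus ?thesis by (simp add: L2_def)
qed

lemma L2_cmult:
  assumes "f \<in> L2 M"
  shows "(\<lambda>x. c * f x) \<in> L2 M"
  using assms by (auto simp: L2_def norm_mult power_mult_distrib)

lemma L2_sum:
  assumes "finite I" "\<And>i. i \<in> I \<Longrightarrow> f i \<in> L2 M"
  shows "(\<lambda>x. \<Sum>i\<in>I. f i x) \<in> L2 M"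
  using assms
proof (induction I rule: finite_induct)
  case (insert i I)
  have "(\<lambda>x. f i x - (- 1) * (\<Sum>i\<in>I. f i x)) \<in> L2 M"
    using insert by (intro L2_diff L2_cmult) auto
  thus ?case using insert by simp
qed (simp add: L2_def)

text \<open>Uniqueness of the adjoint up to a null set; no boundedness of \<open>T\<close> is needed.\<close>

lemma L2_adjoint_AE_eq:
  assumes \<eta>: "\<eta> \<in> L2 M" and adj: "\<And>\<psi>. \<psi> \<in> L2 M \<Longrightarrow> L2_inner M \<psi> \<eta> = L2_inner M (T \<psi>) \<xi>"
  shows "AE x in M. L2_adjoint M T \<xi> x = \<eta> x"
proof -
  define \<eta>' where "\<eta>' = L2_adjoint M T \<xi>"
  have \<eta>': "\<eta>' \<in> L2 M" "\<And>\<psi>. \<psi> \<in> L2 M \<Longrightarrow> L2_inner M \<psi> \<eta>' = L2_inner M (T \<psi>) \<xi>"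
    using someI[of "\<lambda>\<eta>. \<eta> \<in> L2 M \<and> (\<forall>\<psi>\<in>L2 M. L2_inner M \<psi> \<eta> = L2_inner M (T \<psi>) \<xi>)" \<eta>] \<eta> adj
    by (auto simp: \<eta>'_def L2_adjoint_def)
  define \<psi> where "\<psi> x = \<eta>' x - \<eta> x" for x
  have \<psi>: "\<psi> \<in> L2 M" unfolding \<psi>_def by (rule L2_diff) (rule \<eta>' \<eta>)+
  have "(\<integral>x. cnj (\<psi> x) * \<eta>' x \<partial>M) - (\<integral>x. cnj (\<psi> x) * \<eta> x \<partial>M) = 0"
    using \<eta>'(2)[OF \<psi>] adj[OF \<psi>] by (simp add: L2_inner_def)
  hence "(\<integral>x. cnj (\<psi> x) * \<eta>' x - cnj (\<psi> x) * \<eta> x \<partial>M) = 0"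
    using integrable_L2_mult[OF \<psi> \<eta>'(1)] integrable_L2_mult[OF \<psi> \<eta>] by simp
  moreover have "cnj (\<psi> x) * \<eta>' x - cnj (\<psi> x) * \<eta> x = complex_of_real ((cmod (\<psi> x))\<^sup>2)" for x
    unfolding complex_norm_square by (simp add: \<psi>_def algebra_simps)
  ultimately have "(\<integral>x. complex_of_real ((cmod (\<psi> x))\<^sup>2) \<partial>M) = 0" by (simp only:)
  hence "(\<integral>x. (cmod (\<psi> x))\<^sup>2 \<partial>M) = 0" by (simp only: integral_complex_of_real of_real_eq_0_iff)
  hence "AE x in M. (cmod (\<psi> x))\<^sup>2 = 0"
    using integral_nonneg_eq_0_iff_AE[OF L2_integrable[OF \<psi>]] by simp
  thus ?thesis by eventually_elim (simp add: \<psi>_def \<eta>'_def)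
qed

section \<open>The adjoints of the generators and of the composition operator\<close>

text \<open>The function \<open>x \<mapsto> \<xi> (i x)\<close> on \<open>Dset N A i\<close>, extended by zero.\<close>

definition pull_prefix ::
  "nat \<Rightarrow> (nat \<Rightarrow> nat \<Rightarrow> nat) \<Rightarrow> nat \<Rightarrow> ((nat \<Rightarrow> nat) \<Rightarrow> complex) \<Rightarrow> (nat \<Rightarrow> nat) \<Rightarrow> complex" where
  "pull_prefix N A i \<xi> x = indicator (Dset N A i) x *\<^sub>R \<xi> (prefix i x)"

lemma measurable_shift_muA: "shift \<in> measurable (muA N A) (muA N A)"
proof -
  have "shift \<in> measurable (muA N A) (restrict_space borel (Lam N A))"
    by (rule measurable_restrict_space2) (auto simp: shift_in_Lam intro: measurable_muA)
  thus ?thesis using measurable_cong_sets[OF refl sets_muA] by blast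
qed

lemma measurable_shift_Rset:
  "shift \<in> measurable (restrict_space (muA N A) (Rset N A i)) (restrict_space (muA N A) (Dset N A i))"
  by (rule measurable_restrict_space3[OF measurable_shift_muA]) (auto simp: shift_in_Dset)

lemma measurable_compose_prefix:
  assumes "i < N" "\<xi> \<in> borel_measurable (muA N A)"
  shows "(\<lambda>x. \<xi> (prefix i x)) \<in> borel_measurable (restrict_space (muA N A) (Dset N A i))"
  by (rule measurable_compose[OF measurable_prefix[OF assms(1)] measurable_restrict_space1[OF assms(2)]])

lemma L2_pull_prefix:
  assumes N: "2 \<le> N" and i: "i < N" and \<xi>: "\<xi> \<in> L2 (muA N A)"
  shows "pull_prefix N A i \<xi> \<in> L2 (muA N A)"
proof -
  let ?R = "restrict_space (muA N A) (Rset N A i)" and ?D = "restrict_space (muA N A) (Dset N A i)"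
  note m = L2_measurable[OF \<xi>]
  have "pull_prefix N A i \<xi> \<in> borel_measurable (muA N A)"
    unfolding pull_prefix_def[abs_def]
    using measurable_compose_prefix[OF i m] by (subst (asm) borel_measurable_restrict_space_iff) (simp_all add: sets_Dset)
  moreover have "(\<integral>\<^sup>+x. ennreal ((cmod (pull_prefix N A i \<xi> x))\<^sup>2) \<partial>muA N A) < \<infinity>"
  proof -
    let ?I = "\<integral>\<^sup>+x. ennreal ((cmod (\<xi> (prefix i x)))\<^sup>2) \<partial>?D"
    have "(\<integral>\<^sup>+x. ennreal ((cmod (pull_prefix N A i \<xi> x))\<^sup>2) \<partial>muA N A)
        = (\<integral>\<^sup>+x. ennreal ((cmod (\<xi> (prefix i x)))\<^sup>2) * indicator (Dset N A i) x \<partial>muA N A)"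
      by (intro nn_integral_cong) (auto simp: pull_prefix_def indicator_def)
    also have "\<dots> = ?I"
      by (rule nn_integral_restrict_space[symmetric]) (simp add: sets_Dset)
    finally have I: "(\<integral>\<^sup>+x. ennreal ((cmod (pull_prefix N A i \<xi> x))\<^sup>2) \<partial>muA N A) = ?I" .
    moreover have "ennreal (real N powr - dimA N A) * ?I = (\<integral>\<^sup>+x. ennreal ((cmod (\<xi> x))\<^sup>2) \<partial>?R)"
      using measurable_restrict_space1[OF m, of "Rset N A i"]
      by (intro nn_integral_restrict_Rset[OF N i, symmetric]) measurable
    moreover have "(\<integral>\<^sup>+x. ennreal ((cmod (\<xi> x))\<^sup>2) \<partial>?R) \<le> (\<integral>\<^sup>+x. ennreal ((cmod (\<xi> x))\<^sup>2) \<partial>muA N A)"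
      by (subst nn_integral_restrict_space) (auto simp: sets_Rset Int_absorb1[OF Rset_subset] indicator_def intro!: nn_integral_mono)
    moreover have "(\<integral>\<^sup>+x. ennreal ((cmod (\<xi> x))\<^sup>2) \<partial>muA N A) < \<infinity>"
      using \<xi> by (simp add: L2_iff_nn_integral[OF m])
    ultimately have "ennreal (real N powr - dimA N A) * ?I < \<infinity>" by (simp add: le_less_trans)
    hence "?I < \<infinity>" using N by (auto simp: ennreal_mult_less_top)
    thus ?thesis by (simp only: I)
  qed
  ultimately show ?thesis by (simp add: L2_iff_nn_integral)
qed

lemma L2_inner_pull_prefix:
  "L2_inner (muA N A) \<psi> (\<lambda>x. c * pull_prefix N A i \<xi> x) =
     c * (\<integral>x. cnj (\<psi> x) * \<xi> (prefix i x) \<partial>restrict_space (muA N A) (Dset N A i))"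
proof -
  have "(\<integral>x. cnj (\<psi> x) * \<xi> (prefix i x) \<partial>restrict_space (muA N A) (Dset N A i)) =
      (\<integral>x. cnj (\<psi> x) * pull_prefix N A i \<xi> x \<partial>muA N A)"
    by (subst integral_restrict_space) (simp_all add: sets_Dset pull_prefix_def scaleR_conv_of_real mult_ac)
  thus ?thesis
    unfolding L2_inner_def by (simp flip: integral_mult_right_zero add: ac_simps)
qed

text \<open>
  The generator \<open>S_op N A i\<close> has the constant weight \<open>N powr (\<delta> / 2)\<close> almost everywhere, and the
  change of variables along the prefix map contributes \<open>N powr (- \<delta>)\<close>.
\<close>

lemma L2_adjoint_S_op:
  assumes N: "2 \<le> N" and diag: "\<And>j. j < N \<Longrightarrow> A j j = 1" and i: "i < N"
    and \<xi>: "\<xi> \<in> L2 (muA N A)"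
  shows "AE x in muA N A. L2_adjoint (muA N A) (S_op N A i) \<xi> x =
           complex_of_real (real N powr (- dimA N A / 2)) * pull_prefix N A i \<xi> x"
proof (rule L2_adjoint_AE_eq)
  let ?R = "restrict_space (muA N A) (Rset N A i)" and ?D = "restrict_space (muA N A) (Dset N A i)"
  show "(\<lambda>x. complex_of_real (real N powr (- dimA N A / 2)) * pull_prefix N A i \<xi> x) \<in> L2 (muA N A)"
    by (intro L2_cmult L2_pull_prefix[OF N i \<xi>])
  fix \<psi> assume \<psi>: "\<psi> \<in> L2 (muA N A)"
  define w where "w x = complex_of_real (Phi N A i x powr (- 1 / 2))" for x
  have [measurable]: "w \<in> borel_measurable ?D" "\<psi> \<in> borel_measurable ?D" "\<xi> \<in> borel_measurable ?R"
    "(\<lambda>x. \<xi> (prefix i x)) \<in> borel_measurable ?D"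
    using measurable_Phi[of N A i] measurable_restrict_space1[OF L2_measurable[OF \<psi>]]
      measurable_restrict_space1[OF L2_measurable[OF \<xi>]] measurable_compose_prefix[OF i L2_measurable[OF \<xi>]]
    unfolding w_def by measurable
  note [measurable] = measurable_shift_Rset[of N A i]
  have "L2_inner (muA N A) (S_op N A i \<psi>) \<xi>
      = (\<integral>x. indicator (Rset N A i) x *\<^sub>R (w (shift x) * cnj (\<psi> (shift x)) * \<xi> x) \<partial>muA N A)"
    unfolding L2_inner_def S_op_def w_def
    by (intro Bochner_Integration.integral_cong) (auto simp: indicator_def)
  also have "\<dots> = (\<integral>x. w (shift x) * cnj (\<psi> (shift x)) * \<xi> x \<partial>?R)"
    by (rule integral_restrict_space[symmetric]) (simp add: sets_Rset)
  also have "\<dots> = (real N powr - dimA N A) *\<^sub>R (\<integral>x. w x * cnj (\<psi> x) * \<xi> (prefix i x) \<partial>?D)"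
    by (subst integral_restrict_Rset[OF N i]) simp_all
  also have "(\<integral>x. w x * cnj (\<psi> x) * \<xi> (prefix i x) \<partial>?D) =
      (\<integral>x. complex_of_real (real N powr (dimA N A / 2)) * (cnj (\<psi> x) * \<xi> (prefix i x)) \<partial>?D)"
  proof (rule integral_cong_AE)
    have "AE x in ?D. Phi N A i x = real N powr - dimA N A"
      by (rule AE_Phi[OF N _ i]) (rule diag)
    thus "AE x in ?D. w x * cnj (\<psi> x) * \<xi> (prefix i x) =
        complex_of_real (real N powr (dimA N A / 2)) * (cnj (\<psi> x) * \<xi> (prefix i x))"
      by eventually_elim (simp add: w_def powr_powr)
  qed measurable
  also have "(real N powr - dimA N A) *\<^sub>R \<dots> = complex_of_real (real N powr - dimA N A * real N powr (dimA N A / 2)) *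
      (\<integral>x. cnj (\<psi> x) * \<xi> (prefix i x) \<partial>?D)"
    by (simp add: scaleR_conv_of_real)
  also have "real N powr - dimA N A * real N powr (dimA N A / 2) = real N powr (- dimA N A / 2)"
    by (simp add: powr_add[symmetric])
  finally show "L2_inner (muA N A) \<psi> (\<lambda>x. complex_of_real (real N powr (- dimA N A / 2)) * pull_prefix N A i \<xi> x) =
      L2_inner (muA N A) (S_op N A i \<psi>) \<xi>"
    by (simp add: L2_inner_pull_prefix)
qed

lemma sum_indicator_Rset:
  assumes "x \<in> Lam N A"
  shows "(\<Sum>i<N. indicator (Rset N A i) x *\<^sub>R f x) = (f x :: 'b :: real_vector)"
proof -
  have "(\<Sum>i<N. indicator (Rset N A i) x *\<^sub>R f x) = (\<Sum>i<N. if i = x 0 then f x else 0)"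
    using assms by (intro sum.cong) (auto simp: Rset_def)
  also have "\<dots> = f x" using assms by (simp add: Lam_def)
  finally show ?thesis .
qed

text \<open>Each of the \<open>N\<close> branches contributes at most \<open>N powr (- \<delta>)\<close> times the square norm of \<open>\<psi>\<close>.\<close>

lemma L2_T_shift:
  assumes N: "2 \<le> N" and \<psi>: "\<psi> \<in> L2 (muA N A)"
  shows "T_shift \<psi> \<in> L2 (muA N A)"
proof -
  let ?R = "\<lambda>i. restrict_space (muA N A) (Rset N A i)" and ?D = "\<lambda>i. restrict_space (muA N A) (Dset N A i)"
  let ?f = "\<lambda>x. ennreal ((cmod (\<psi> x))\<^sup>2)"
  note m [measurable] = L2_measurable[OF \<psi>]
  have T [measurable]: "T_shift \<psi> \<in> borel_measurable (muA N A)"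
    unfolding T_shift_def[abs_def] by (rule measurable_compose[OF measurable_shift_muA m])
  have fin: "integral\<^sup>N (muA N A) ?f < \<infinity>"
    using \<psi> by (simp add: L2_iff_nn_integral[OF m])
  have "(\<integral>\<^sup>+x. ennreal ((cmod (T_shift \<psi> x))\<^sup>2) \<partial>muA N A)
      = (\<integral>\<^sup>+x. (\<Sum>i<N. ennreal ((cmod (T_shift \<psi> x))\<^sup>2) * indicator (Rset N A i) x) \<partial>muA N A)"
  proof (rule nn_integral_cong)
    fix x assume "x \<in> space (muA N A)"
    hence x: "x \<in> Lam N A" by simp
    hence "(\<Sum>i<N. ennreal ((cmod (T_shift \<psi> x))\<^sup>2) * indicator (Rset N A i) x)
        = (\<Sum>i<N. if i = x 0 then ennreal ((cmod (T_shift \<psi> x))\<^sup>2) else 0)"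
      by (intro sum.cong) (auto simp: Rset_def)
    also have "\<dots> = ennreal ((cmod (T_shift \<psi> x))\<^sup>2)" using x by (simp add: Lam_def)
    finally show "ennreal ((cmod (T_shift \<psi> x))\<^sup>2) =
        (\<Sum>i<N. ennreal ((cmod (T_shift \<psi> x))\<^sup>2) * indicator (Rset N A i) x)" ..
  qed
  also have "\<dots> = (\<Sum>i<N. \<integral>\<^sup>+x. ennreal ((cmod (T_shift \<psi> x))\<^sup>2) * indicator (Rset N A i) x \<partial>muA N A)"
    by (rule nn_integral_sum) (use sets_Rset[of N A] in measurable)
  also have "\<dots> < \<infinity>"
  proof -
    have "(\<integral>\<^sup>+x. ennreal ((cmod (T_shift \<psi> x))\<^sup>2) * indicator (Rset N A i) x \<partial>muA N A) < \<infinity>" if i: "i < N" for i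
    proof -
      have "(\<integral>\<^sup>+x. ennreal ((cmod (T_shift \<psi> x))\<^sup>2) * indicator (Rset N A i) x \<partial>muA N A)
          = (\<integral>\<^sup>+x. ennreal ((cmod (T_shift \<psi> x))\<^sup>2) \<partial>?R i)"
        by (rule nn_integral_restrict_space[symmetric]) (simp add: sets_Rset)
      also have "\<dots> = ennreal (real N powr - dimA N A) * integral\<^sup>N (?D i) ?f"
        using measurable_restrict_space1[OF T, of "Rset N A i"]
        by (subst nn_integral_restrict_Rset[OF N i], measurable) (simp add: T_shift_def)
      also have "integral\<^sup>N (?D i) ?f \<le> integral\<^sup>N (muA N A) ?f"
        by (subst nn_integral_restrict_space) (auto simp: sets_Dset Int_absorb1[OF Dset_subset] indicator_def intro!: nn_integral_mono)
      finally show ?thesis using fin by (auto simp: ennreal_mult_less_top mult_left_mono elim!: le_less_trans)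
    qed
    thus ?thesis by simp
  qed
  finally show ?thesis by (simp add: L2_iff_nn_integral[OF T])
qed

lemma perron_frobenius_AE_eq:
  assumes N: "2 \<le> N" and \<xi>: "\<xi> \<in> L2 (muA N A)"
  shows "AE x in muA N A. perron_frobenius N A \<xi> x =
           (\<Sum>i<N. complex_of_real (real N powr - dimA N A) * pull_prefix N A i \<xi> x)"
  unfolding perron_frobenius_def
proof (rule L2_adjoint_AE_eq)
  let ?R = "\<lambda>i. restrict_space (muA N A) (Rset N A i)" and ?D = "\<lambda>i. restrict_space (muA N A) (Dset N A i)"
  let ?c = "complex_of_real (real N powr - dimA N A)"
  show "(\<lambda>x. \<Sum>i<N. ?c * pull_prefix N A i \<xi> x) \<in> L2 (muA N A)"
    by (intro L2_sum L2_cmult L2_pull_prefix[OF N _ \<xi>]) auto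
  fix \<psi> assume \<psi>: "\<psi> \<in> L2 (muA N A)"
  define g where "g x = cnj (T_shift \<psi> x) * \<xi> x" for x
  have g: "integrable (muA N A) g"
    unfolding g_def by (rule integrable_L2_mult[OF L2_T_shift[OF N \<psi>] \<xi>])
  have "L2_inner (muA N A) (T_shift \<psi>) \<xi> = (\<integral>x. (\<Sum>i<N. indicator (Rset N A i) x *\<^sub>R g x) \<partial>muA N A)"
    unfolding L2_inner_def
    by (rule Bochner_Integration.integral_cong[OF refl]) (simp only: space_muA sum_indicator_Rset, simp only: g_def)
  also have "\<dots> = (\<Sum>i<N. \<integral>x. indicator (Rset N A i) x *\<^sub>R g x \<partial>muA N A)"
    by (intro Bochner_Integration.integral_sum integrable_mult_indicator sets_Rset g)
  also have "\<dots> = (\<Sum>i<N. ?c * (\<integral>x. cnj (\<psi> x) * \<xi> (prefix i x) \<partial>?D i))"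
  proof (rule sum.cong[OF refl])
    fix i assume "i \<in> {..<N}"
    hence i: "i < N" by simp
    have "(\<integral>x. indicator (Rset N A i) x *\<^sub>R g x \<partial>muA N A) = integral\<^sup>L (?R i) g"
      by (rule integral_restrict_space[symmetric]) (simp add: sets_Rset)
    also have "\<dots> = (real N powr - dimA N A) *\<^sub>R (\<integral>x. g (prefix i x) \<partial>?D i)"
      by (rule integral_restrict_Rset[OF N i]) (use g in \<open>auto intro: measurable_restrict_space1\<close>)
    finally show "(\<integral>x. indicator (Rset N A i) x *\<^sub>R g x \<partial>muA N A) =
        ?c * (\<integral>x. cnj (\<psi> x) * \<xi> (prefix i x) \<partial>?D i)"
      by (simp add: g_def T_shift_def scaleR_conv_of_real)
  qed
  also have "\<dots> = (\<Sum>i<N. L2_inner (muA N A) \<psi> (\<lambda>x. ?c * pull_prefix N A i \<xi> x))"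
    by (simp only: L2_inner_pull_prefix)
  also have "\<dots> = (\<integral>x. (\<Sum>i<N. cnj (\<psi> x) * (?c * pull_prefix N A i \<xi> x)) \<partial>muA N A)"
    unfolding L2_inner_def
    by (intro Bochner_Integration.integral_sum[symmetric] integrable_L2_mult[OF \<psi>] L2_cmult L2_pull_prefix[OF N _ \<xi>]) auto
  also have "\<dots> = L2_inner (muA N A) \<psi> (\<lambda>x. \<Sum>i<N. ?c * pull_prefix N A i \<xi> x)"
    by (simp add: L2_inner_def sum_distrib_left)
  finally show "L2_inner (muA N A) \<psi> (\<lambda>x. \<Sum>i<N. ?c * pull_prefix N A i \<xi> x) =
      L2_inner (muA N A) (T_shift \<psi>) \<xi>" by simp
qed

theorem corollary2p18:
  fixes N :: nat and A :: "nat \<Rightarrow> nat \<Rightarrow> nat" and \<xi> :: "(nat \<Rightarrow> nat) \<Rightarrow> complex"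
  assumes "N \<ge> 2"
    and "\<And>i j. i < N \<Longrightarrow> j < N \<Longrightarrow> A i j \<in> {0, 1}"
    and "\<And>i. i < N \<Longrightarrow> A i i = 1"
    and "\<xi> \<in> L2 (muA N A)"
  shows "AE x in muA N A. perron_frobenius N A \<xi> x =
           complex_of_real (real N powr (- dimA N A / 2)) *
           (\<Sum>i<N. L2_adjoint (muA N A) (S_op N A i) \<xi> x)"
proof -
  let ?c = "complex_of_real (real N powr (- dimA N A / 2))"
  have "AE x in muA N A. \<forall>i\<in>{..<N}. L2_adjoint (muA N A) (S_op N A i) \<xi> x = ?c * pull_prefix N A i \<xi> x"
    using assms L2_adjoint_S_op by (intro AE_finite_allI) auto
  moreover have "AE x in muA N A. perron_frobenius N A \<xi> x =
      (\<Sum>i<N. complex_of_real (real N powr - dimA N A) * pull_prefix N A i \<xi> x)"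
    by (rule perron_frobenius_AE_eq) (use assms in auto)
  ultimately show ?thesis
  proof eventually_elim
    case (elim x)
    have "complex_of_real (real N powr - dimA N A) = ?c * ?c"
      by (simp add: powr_add[symmetric] flip: of_real_mult)
    thus ?case using elim by (simp add: sum_distrib_left mult.assoc)
  qed
qed

end
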